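(* For every integer $p\geq 0$ there exists a topological graph $\mathcal{G}$ with $P_h(\mathcal{G})=\{p,p+1,p+2,\ldots\}\cup\{+\infty\}$.
   Context: A topological graph is a compact connected metric space which is a finite union of arcs (spaces homeomorphic to $[0,1]$; the points corresponding to $0,1$ are the end points) such that any two of these arcs intersect in at most their end points. For a topological space $A$, $Homeo(A)$ denotes the group of all homeomorphisms $A\to A$ under composition. For a subgroup $G$ of $Homeo(A)$ (acting by $gx=g(x)$), a nonempty subset $Y\subseteq A$ is invariant if $g(y)\in Y$ for all $g\in G$, $y\in Y$. The height of $(G,A)$ is $h(G,A)=\sup\{n\geq 0:$ there exist distinct closed invariant subsets $Y_0\subset Y_1\subset\cdots\subset Y_n=A\}$ (possibly $+\infty$). Finally $P_h(A)=\{h(G,A): G \text{ is a subgroup of } Homeo(A)\}$, i.e. the set of heights of all transformation groups with phase space $A$. *)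

theory Defs
  imports "HOL-Analysis.Analysis" "HOL-Library.Extended_Nat"
begin

text \<open>A topological graph, realised as a subspace of Euclidean 3-space
  (every topological graph embeds in R^3). It is compact, connected, and a
  finite (nonempty) union of arcs, any two distinct ones of which meet at most
  in common end points.\<close>
definition topological_graph :: "(real^3) set \<Rightarrow> bool" where
  "topological_graph A \<longleftrightarrow> compact A \<and> connected A \<and>
     (\<exists>gs :: (real \<Rightarrow> real^3) list. gs \<noteq> [] \<and>
        (\<forall>g \<in> set gs. arc g) \<and>
        A = (\<Union>g \<in> set gs. path_image g) \<and>
        (\<forall>i < length gs. \<forall>j < length gs. i \<noteq> j \<longrightarrow>
           path_image (gs!i) \<inter> path_image (gs!j) \<subseteq>
             {pathstart (gs!i), pathfinish (gs!i)} \<inter> {pathstart (gs!j), pathfinish (gs!j)}))"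

text \<open>Homeo(A): homeomorphisms of A, normalised to be the identity outside A
  so that equality of group elements is equality as maps on A.\<close>
definition Homeo :: "'a::topological_space set \<Rightarrow> ('a \<Rightarrow> 'a) set" where
  "Homeo A = {f. (\<exists>g. homeomorphism A A f g) \<and> (\<forall>x. x \<notin> A \<longrightarrow> f x = x)}"

definition homeo_subgroup :: "('a::topological_space \<Rightarrow> 'a) set \<Rightarrow> 'a set \<Rightarrow> bool" where
  "homeo_subgroup G A \<longleftrightarrow> G \<subseteq> Homeo A \<and> id \<in> G \<and>
     (\<forall>f \<in> G. \<forall>g \<in> G. f \<circ> g \<in> G) \<and> (\<forall>f \<in> G. inv f \<in> G)"

definition invariant_set :: "('a \<Rightarrow> 'a) set \<Rightarrow> 'a set \<Rightarrow> 'a set \<Rightarrow> bool" where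
  "invariant_set G A Y \<longleftrightarrow> Y \<noteq> {} \<and> Y \<subseteq> A \<and> (\<forall>g \<in> G. \<forall>y \<in> Y. g y \<in> Y)"

definition height :: "('a::topological_space \<Rightarrow> 'a) set \<Rightarrow> 'a set \<Rightarrow> enat" where
  "height G A = Sup {enat n | n. \<exists>Y :: nat \<Rightarrow> 'a set.
      (\<forall>i \<le> n. closedin (top_of_set A) (Y i) \<and> invariant_set G A (Y i)) \<and>
      (\<forall>i < n. Y i \<subset> Y (Suc i)) \<and> Y n = A}"

definition P_h :: "'a::topological_space set \<Rightarrow> enat set" where
  "P_h A = {height G A | G. homeo_subgroup G A}"

end

theory Submission
  imports Defs
begin

text \<open>The graph is a chain of \<open>p + 1\<close> circles, each touching the next: the union of the curves
  \<open>y = sin (\<pi> x)\<close> and \<open>y = - sin (\<pi> x)\<close> over \<open>[0, M]\<close>, where \<open>M = p + 1\<close>. Its cut points are the \<open>p\<close>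
  points where circles touch, and the number of cut points on the two sides of a cut point is
  a topological invariant; hence every homeomorphism preserves, up to the reflection
  \<open>x \<mapsto> M - x\<close>, the position along the chain. Folding by this reflection gives a chain of
  \<open>p + 1\<close> closed sets invariant under all homeomorphisms, so every height is at least \<open>p\<close>.

  Conversely, a group whose orbits are the level sets of a labelling with values \<open>0, \<dots>, n\<close>
  has height at most \<open>n\<close>, and exactly \<open>n\<close> if the sublevel sets are closed. Take all
  homeomorphisms that preserve the touching points, \<open>e\<close> further fibres near each end of
  the chain and, optionally, the two end points of the chain: their orbits are the marked fibres
  and the folded segments in between. Each additional fibre adds one point orbit and one segment
  orbit, the end points add one orbit, so all \<open>n \<ge> p\<close> occur. The trivial group has infinite
  height.\<close>

section \<open>Heights and orbits\<close>

lemma homeomorphism_imp_Homeo: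
  assumes "homeomorphism A A f g"
  shows "(\<lambda>x. if x \<in> A then f x else x) \<in> Homeo A"
proof -
  have "homeomorphism A A (\<lambda>x. if x \<in> A then f x else x) (\<lambda>x. if x \<in> A then g x else x)"
    using assms by (rule homeomorphism_cong) (auto simp: homeomorphism_def)
  then show ?thesis
    unfolding Homeo_def by auto
qed

lemma Homeo_id: "id \<in> Homeo A"
  unfolding Homeo_def using homeomorphism_ident[of A] by (auto simp: id_def)

lemma Homeo_comp:
  assumes "f \<in> Homeo A" "g \<in> Homeo A"
  shows "f \<circ> g \<in> Homeo A"
proof -
  obtain f' g' where "homeomorphism A A f f'" "homeomorphism A A g g'"
    using assms unfolding Homeo_def by auto
  then have "homeomorphism A A (f \<circ> g) (g' \<circ> f')"
    using homeomorphism_compose by blast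
  then show ?thesis
    using assms unfolding Homeo_def by auto
qed

lemma Homeo_inv:
  assumes "f \<in> Homeo A"
  shows "inv f \<in> Homeo A" "bij f" "f ` A = A"
proof -
  obtain g where hom: "homeomorphism A A f g" and out: "\<And>x. x \<notin> A \<Longrightarrow> f x = x"
    using assms unfolding Homeo_def by auto
  define h where "h = (\<lambda>x. if x \<in> A then g x else x)"
  have A: "\<And>x. x \<in> A \<Longrightarrow> f x \<in> A" "\<And>x. x \<in> A \<Longrightarrow> g x \<in> A"
      "\<And>x. x \<in> A \<Longrightarrow> g (f x) = x" "\<And>x. x \<in> A \<Longrightarrow> f (g x) = x"
    using hom unfolding homeomorphism_def by auto
  have hf: "h (f x) = x" for x
    by (cases "x \<in> A") (simp_all add: h_def A out)
  have fh: "f (h x) = x" for x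
    by (cases "x \<in> A") (simp_all add: h_def A out)
  have "inv f = h"
    using hf fh by (rule inv_equality)
  moreover have "h \<in> Homeo A"
    unfolding h_def by (rule homeomorphism_imp_Homeo) (use hom homeomorphism_symD in blast)
  ultimately show "inv f \<in> Homeo A"
    by simp
  show "bij f"
    by (rule o_bij[of h]) (simp_all add: fun_eq_iff hf fh)
  show "f ` A = A"
    using hom unfolding homeomorphism_def by auto
qed

text \<open>This is the largest group of homeomorphisms with \<open>l\<close> constant on orbits.
  Transitivity on a level set of \<open>l\<close> thus only requires constructing homeomorphisms
  that respect \<open>l\<close>.\<close>

definition label_group :: "('a::topological_space \<Rightarrow> 'b) \<Rightarrow> 'a set \<Rightarrow> ('a \<Rightarrow> 'a) set" where
  "label_group l A = {f \<in> Homeo A. \<forall>x \<in> A. l (f x) = l x}"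

lemma homeo_subgroup_label_group: "homeo_subgroup (label_group l A) A"
proof -
  have "inv f \<in> label_group l A" if f: "f \<in> label_group l A" for f
  proof -
    have H: "f \<in> Homeo A" and l: "\<And>x. x \<in> A \<Longrightarrow> l (f x) = l x"
      using f by (auto simp: label_group_def)
    have "l (inv f x) = l x" if "x \<in> A" for x
    proof -
      have "inv f x \<in> A"
        using Homeo_inv(3)[OF Homeo_inv(1)[OF H]] that by blast
      then have "l (f (inv f x)) = l (inv f x)"
        by (rule l)
      then show ?thesis
        using Homeo_inv(2)[OF H] by (simp add: bij_is_surj surj_f_inv_f)
    qed
    then show ?thesis
      using Homeo_inv(1)[OF H] by (simp add: label_group_def)
  qed
  moreover have "f \<circ> g \<in> label_group l A" if "f \<in> label_group l A" "g \<in> label_group l A" for f g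
  proof -
    have "g x \<in> A" if "x \<in> A" for x
      using Homeo_inv(3)[of g A] \<open>g \<in> _\<close> that by (auto simp: label_group_def)
    then show ?thesis
      using that Homeo_comp by (auto simp: label_group_def)
  qed
  ultimately show ?thesis
    unfolding homeo_subgroup_def by (auto simp: label_group_def Homeo_id)
qed

section \<open>Orbits and the two height bounds\<close>

definition same_orbit :: "('a \<Rightarrow> 'a) set \<Rightarrow> 'a \<Rightarrow> 'a \<Rightarrow> bool" where
  "same_orbit G x y \<longleftrightarrow> (\<exists>f \<in> G. f x = y)"

lemma same_orbit_refl: "homeo_subgroup G A \<Longrightarrow> same_orbit G x x"
  unfolding same_orbit_def homeo_subgroup_def by (metis id_apply)

lemma same_orbit_trans:
  "\<lbrakk>homeo_subgroup G A; same_orbit G x y; same_orbit G y z\<rbrakk> \<Longrightarrow> same_orbit G x z"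
  unfolding same_orbit_def homeo_subgroup_def by (metis comp_apply)

lemma same_orbit_sym:
  assumes G: "homeo_subgroup G A" and "same_orbit G x y"
  shows "same_orbit G y x"
proof -
  obtain f where f: "f \<in> G" "f x = y"
    using assms(2) by (auto simp: same_orbit_def)
  then have "inv f \<in> G" "bij f"
    using G Homeo_inv(2) unfolding homeo_subgroup_def by auto
  moreover have "inv f y = x"
    using f \<open>bij f\<close> by (simp add: bij_is_inj inv_f_eq)
  ultimately show ?thesis
    unfolding same_orbit_def by blast
qed

text \<open>The sublevel sets of \<open>l\<close> form the chain: they are invariant because
  \<open>l\<close> is constant on orbits, and they grow strictly because every value up to
  \<open>n\<close> is attained.\<close>

lemma enat_le_height:
  fixes l :: "'a::topological_space \<Rightarrow> nat"
  assumes G: "homeo_subgroup G A"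
    and inv: "\<And>f x. \<lbrakk>f \<in> G; x \<in> A\<rbrakk> \<Longrightarrow> l (f x) = l x"
    and closed: "\<And>j. closedin (top_of_set A) {x \<in> A. l x \<le> j}"
    and img: "l ` A = {..n}"
  shows "enat n \<le> height G A"
proof -
  define Y where "Y j = {x \<in> A. l x \<le> j}" for j
  have GA: "f x \<in> A" if "f \<in> G" "x \<in> A" for f x
    using G Homeo_inv(3) that unfolding homeo_subgroup_def by blast
  have hit: "\<exists>x \<in> A. l x = j" if "j \<le> n" for j
  proof -
    have "j \<in> l ` A"
      using that by (simp add: img)
    then show ?thesis
      by blast
  qed
  have "invariant_set G A (Y j)" if "j \<le> n" for j
  proof -
    obtain x where "x \<in> A" "l x = 0"
      using hit[of 0] by blast
    then have "x \<in> Y j"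
      by (simp add: Y_def)
    moreover have "f y \<in> Y j" if "f \<in> G" "y \<in> Y j" for f y
      using that GA[of f y] inv[of f y] by (simp add: Y_def)
    moreover have "Y j \<subseteq> A"
      by (auto simp: Y_def)
    ultimately show ?thesis
      unfolding invariant_set_def by blast
  qed
  moreover have "Y j \<subset> Y (Suc j)" if jn: "j < n" for j
  proof -
    obtain x where "x \<in> A" "l x = Suc j"
      using hit[of "Suc j"] Suc_leI[OF jn] by blast
    then have "x \<in> Y (Suc j)" "x \<notin> Y j"
      by (auto simp: Y_def)
    moreover have "Y j \<subseteq> Y (Suc j)"
      by (auto simp: Y_def)
    ultimately show ?thesis
      by blast
  qed
  moreover have "Y n = A"
    using img unfolding Y_def by blast
  moreover have "closedin (top_of_set A) (Y j)" for j
    using closed by (simp add: Y_def)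
  ultimately have "\<exists>Y. (\<forall>i\<le>n. closedin (top_of_set A) (Y i) \<and> invariant_set G A (Y i)) \<and>
      (\<forall>i<n. Y i \<subset> Y (Suc i)) \<and> Y n = A"
    by (intro exI[of _ Y]) simp
  then show ?thesis
    unfolding height_def by (intro Sup_upper) simp
qed

text \<open>An invariant set contains every level set that it meets. A strict inclusion of invariant
  sets therefore adds a label, and only \<open>n + 1\<close> labels exist.\<close>

lemma height_le_enat:
  fixes l :: "'a::topological_space \<Rightarrow> nat"
  assumes trans: "\<And>x y. \<lbrakk>x \<in> A; y \<in> A; l x = l y\<rbrakk> \<Longrightarrow> same_orbit G x y"
    and img: "l ` A = {..n}"
  shows "height G A \<le> enat n"
  unfolding height_def
proof (rule Sup_least)
  fix k assume "k \<in> {enat n |n. \<exists>Y. (\<forall>i\<le>n. closedin (top_of_set A) (Y i) \<and>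
    invariant_set G A (Y i)) \<and> (\<forall>i<n. Y i \<subset> Y (Suc i)) \<and> Y n = A}"
  then obtain m Y where k: "k = enat m"
    and Y: "\<forall>i\<le>m. closedin (top_of_set A) (Y i) \<and> invariant_set G A (Y i)"
    and strict: "\<forall>i<m. Y i \<subset> Y (Suc i)"
    by blast
  \<comment> \<open>The inequality is strict because the nonempty set \<open>Y 0\<close> already
    carries one label; so \<open>m < n + 1\<close> results at the end.\<close>
  have "i < card (l ` Y i)" if "i \<le> m" for i
    using that
  proof (induction i)
    case 0
    have "l ` Y 0 \<noteq> {}" "l ` Y 0 \<subseteq> {..n}"
      unfolding img[symmetric] using Y by (simp_all add: invariant_set_def image_mono)
    moreover from this have "finite (l ` Y 0)"
      using finite_subset by blast
    ultimately show ?case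
      by (simp add: card_gt_0_iff)
  next
    case (Suc i)
    have inv: "invariant_set G A (Y i)" "invariant_set G A (Y (Suc i))"
      using Y Suc.prems by auto
    obtain y where y: "y \<in> Y (Suc i)" "y \<notin> Y i"
      using strict Suc.prems by (auto simp: Suc_le_eq dest!: spec[of _ i])
    have "l y \<notin> l ` Y i"
    proof
      assume "l y \<in> l ` Y i"
      then obtain x where x: "x \<in> Y i" "l x = l y"
        by auto
      moreover from this have "x \<in> A" "y \<in> A"
        using inv y(1) by (auto simp: invariant_set_def)
      ultimately obtain f where "f \<in> G" "f x = y"
        using trans[of x y] by (auto simp: same_orbit_def)
      then show False
        using inv(1) x(1) y(2) by (auto simp: invariant_set_def)
    qed
    moreover have "l ` Y i \<subseteq> l ` Y (Suc i)"
      using strict Suc.prems by (intro image_mono psubset_imp_subset) simp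
    ultimately have "l ` Y i \<subset> l ` Y (Suc i)"
      using y(1) by blast
    moreover have "finite (l ` Y (Suc i))"
    proof (rule finite_subset)
      show "l ` Y (Suc i) \<subseteq> {..n}"
        unfolding img[symmetric] using inv(2) by (intro image_mono) (simp add: invariant_set_def)
    qed simp
    ultimately have "card (l ` Y i) < card (l ` Y (Suc i))"
      by (rule psubset_card_mono[rotated])
    then show ?case
      using Suc by simp
  qed
  from this[of m] have "m < card (l ` Y m)"
    by simp
  also have "card (l ` Y m) \<le> card {..n}"
  proof (rule card_mono)
    show "l ` Y m \<subseteq> {..n}"
      unfolding img[symmetric] using Y by (intro image_mono) (simp add: invariant_set_def)
  qed simp
  finally show "k \<le> enat n"
    by (simp add: k)
qed

lemma height_trivial_group:
  fixes A :: "'a::t1_space set"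
  assumes "infinite A"
  shows "height {id} A = \<infinity>"
proof -
  have "enat n \<le> height {id} A" for n
  proof -
    obtain B where B: "finite B" "card B = n" "B \<subseteq> A"
      using infinite_arbitrarily_large[OF assms] by blast
    then obtain b where b: "bij_betw b {..<n} B"
      using ex_bij_betw_nat_finite atLeast0LessThan by metis
    \<comment> \<open>The \<open>n\<close> chosen points get the labels below \<open>n\<close> and
      all others the top label \<open>n\<close>, so sublevel sets below the top are finite and hence
      closed.\<close>
    define l where "l x = (if x \<in> B then inv_into {..<n} b x else n)" for x
    have lB: "l x < n" "b (l x) = x" if "x \<in> B" for x
      using b that by (auto simp: l_def bij_betw_def f_inv_into_f intro: inv_into_into)
    show ?thesis
    proof (rule enat_le_height[where l = l])
      show "homeo_subgroup {id} A"
        by (auto simp: homeo_subgroup_def Homeo_id)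
      show "closedin (top_of_set A) {x \<in> A. l x \<le> j}" for j
      proof (cases "j < n")
        case True
        then have "{x \<in> A. l x \<le> j} \<subseteq> B"
          by (auto simp: l_def split: if_splits)
        then show ?thesis
          using B by (intro closed_subset finite_imp_closed) (auto intro: finite_subset)
      next
        case False
        then have "{x \<in> A. l x \<le> j} = A"
          using lB(1) by (force simp: l_def)
        then show ?thesis
          by simp
      qed
      show "l ` A = {..n}"
      proof (intro set_eqI iffI)
        fix j assume "j \<in> l ` A"
        then show "j \<in> {..n}"
          using lB(1) by (auto simp: l_def less_imp_le)
      next
        fix j assume "j \<in> {..n}"
        then consider "j < n" | "j = n"
          by fastforce
        then show "j \<in> l ` A"
        proof cases
          case 1
          then have "b j \<in> B" "l (b j) = j"
            using b by (auto simp: l_def bij_betw_def)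
          then show ?thesis
            using B by force
        next
          case 2
          obtain x where "x \<in> A" "x \<notin> B"
            using assms B by (metis finite_subset subsetI)
          then show ?thesis
            using 2 by (auto simp: l_def image_iff)
        qed
      qed
    qed auto
  qed
  then have "height {id} A \<noteq> enat n" for n
    using Suc_n_not_le_n enat_ord_simps(1) by metis
  then show ?thesis
    using not_enat_eq by blast
qed

section \<open>Chains of circles and their homeomorphisms\<close>

definition pt :: "real \<Rightarrow> real \<Rightarrow> real^3" where
  "pt x y = vector [x, y, 0]"

lemma pt_nth [simp]: "pt x y $ 1 = x" "pt x y $ 2 = y" "pt x y $ 3 = 0"
  by (simp_all add: pt_def)

lemma pt_eq_iff [simp]: "pt x y = pt x' y' \<longleftrightarrow> x = x' \<and> y = y'"
  by (auto dest: arg_cong[of _ _ "\<lambda>z. z $ 1"] arg_cong[of _ _ "\<lambda>z. z $ 2"])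

lemma continuous_on_pt [continuous_intros]:
  assumes "continuous_on S f" "continuous_on S g"
  shows "continuous_on S (\<lambda>x. pt (f x) (g x))"
proof -
  have "continuous_on S (\<lambda>x. pt (f x) (g x) $ i)" for i
    using assms exhaust_3[of i] by (elim disjE) simp_all
  then have "continuous_on S (\<lambda>x. \<chi> i. pt (f x) (g x) $ i)"
    by (rule continuous_on_vec_lambda)
  then show ?thesis
    by (simp only: vec_nth_inverse)
qed

definition sine_curve :: "real set \<Rightarrow> real \<Rightarrow> (real^3) set" where
  "sine_curve J c = (\<lambda>x. pt x (c * sin (x * pi))) ` J"

lemma connected_sine_curve: "connected J \<Longrightarrow> connected (sine_curve J c)"
  unfolding sine_curve_def by (intro connected_continuous_image continuous_intros)

lemma compact_sine_curve: "compact J \<Longrightarrow> compact (sine_curve J c)"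
  unfolding sine_curve_def by (intro compact_continuous_image continuous_intros)

lemma pt_in_sine_curve [simp]: "pt x y \<in> sine_curve J c \<longleftrightarrow> x \<in> J \<and> y = c * sin (x * pi)"
  by (auto simp: sine_curve_def)

definition circle_chain :: "nat \<Rightarrow> (real^3) set" where
  "circle_chain M = sine_curve {0..real M} 1 \<union> sine_curve {0..real M} (-1)"

lemma pt_in_circle_chain [simp]:
  "pt x y \<in> circle_chain M \<longleftrightarrow> x \<in> {0..real M} \<and> \<bar>y\<bar> = \<bar>sin (x * pi)\<bar>"
  unfolding circle_chain_def by (simp add: abs_eq_iff conj_disj_distribL)

lemma circle_chainE_sine:
  assumes "z \<in> circle_chain M"
  obtains x c where "z = pt x (c * sin (x * pi))" "x \<in> {0..real M}" "c = 1 \<or> c = -1"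
  using assms unfolding circle_chain_def sine_curve_def by blast

lemma circle_chainE:
  assumes "z \<in> circle_chain M"
  obtains x y where "z = pt x y" "x \<in> {0..real M}" "\<bar>y\<bar> = \<bar>sin (x * pi)\<bar>"
proof -
  obtain x c where "z = pt x (c * sin (x * pi))" "x \<in> {0..real M}" "c = 1 \<or> c = -1"
    using assms by (rule circle_chainE_sine)
  then show ?thesis
    by (intro that[of x "c * sin (x * pi)"]) (auto simp: abs_mult)
qed

lemma compact_circle_chain: "compact (circle_chain M)"
  unfolding circle_chain_def by (intro compact_Un compact_sine_curve) auto

lemma infinite_circle_chain:
  assumes "M > 0"
  shows "infinite (circle_chain M)"
proof
  assume "finite (circle_chain M)"
  then have "finite ((\<lambda>z. z $ 1) ` circle_chain M)"
    by simp
  moreover have "{0..real M} \<subseteq> (\<lambda>z. z $ 1) ` circle_chain M"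
  proof
    fix x assume "x \<in> {0..real M}"
    then have "pt x (sin (x * pi)) \<in> circle_chain M"
      by simp
    then show "x \<in> (\<lambda>z. z $ 1) ` circle_chain M"
      by (metis imageI pt_nth(1))
  qed
  ultimately have "finite {0..real M}"
    by (rule finite_subset[rotated])
  then show False
    using assms infinite_Icc[of 0 "real M"] by simp
qed

text \<open>The \<open>2 * M\<close> arcs lie over the intervals \<open>[i, i + 1]\<close>, one for
  each sign \<open>c\<close>. A common point of two arcs has integral abscissa: over the same
  interval the signs differ, so the sine vanishes; over different intervals only end points are
  shared.\<close>

lemma topological_graph_circle_chain:
  assumes "M > 0"
  shows "topological_graph (circle_chain M)"
proof -
  define e :: "nat \<times> real \<Rightarrow> real \<Rightarrow> real^3"
    where "e = (\<lambda>(i, c) t. pt (real i + t) (c * sin ((real i + t) * pi)))"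
  define ks where "ks = List.product [0..<M] [1, -1 :: real]"
  have set_ks: "set ks = {..<M} \<times> {1, -1}"
    unfolding ks_def by auto
  have dist_ks: "distinct ks"
    unfolding ks_def by (intro distinct_product) auto
  have img: "path_image (e (i, c)) = sine_curve {real i..real i + 1} c" for i c
  proof -
    have "path_image (e (i, c)) = (\<lambda>x. pt x (c * sin (x * pi))) ` ((+) (real i) ` {0..1})"
      unfolding path_image_def e_def image_image by simp
    then show ?thesis
      by (simp add: sine_curve_def add.commute)
  qed
  have int0: "sin (real_of_int k * pi) = 0" for k
    by (simp add: sin_times_pi_eq_0)
  have ends: "pathstart (e (i, c)) = pt (real i) 0" "pathfinish (e (i, c)) = pt (real i + 1) 0" for i c
    using int0[of "int i"] int0[of "int i + 1"] by (auto simp: pathstart_def pathfinish_def e_def)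
  have "arc (e k)" for k
    by (auto simp: arc_def path_def e_def split_beta inj_on_def intro!: continuous_intros)
  then have arcs: "\<forall>g \<in> set (map e ks). arc g"
    by simp
  have union: "circle_chain M = (\<Union>g \<in> set (map e ks). path_image g)"
  proof -
    have "sine_curve {0..real M} c = (\<Union>i<M. sine_curve {real i..real i + 1} c)" for c
    proof -
      have "\<exists>i<M. real i \<le> x \<and> x \<le> real i + 1" if x: "0 \<le> x" "x \<le> real M" for x
      \<comment> \<open>The floor of \<open>x\<close> selects the interval, except at the right end
        point, which belongs to the last one.\<close>
      proof (cases "x = real M")
        case True
        then show ?thesis
          using assms by (intro exI[of _ "M - 1"]) (auto simp: of_nat_diff)
      next
        case False
        then show ?thesis
          using x by (intro exI[of _ "nat \<lfloor>x\<rfloor>"]) (simp add: nat_less_iff floor_less_iff; linarith)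
      qed
      then have "{0..real M} = (\<Union>i<M. {real i..real i + 1})"
        by fastforce
      then show ?thesis
        by (simp add: sine_curve_def image_UN)
    qed
    then show ?thesis
      by (auto simp: circle_chain_def set_ks img)
  qed
  have "path_image (e k) \<inter> path_image (e l) \<subseteq>
      {pathstart (e k), pathfinish (e k)} \<inter> {pathstart (e l), pathfinish (e l)}"
    if kl: "k \<in> set ks" "l \<in> set ks" "k \<noteq> l" for k l
  proof -
    obtain i c j d where k: "k = (i, c)" and l: "l = (j, d)"
      by (metis surj_pair)
    have cd: "c \<in> {1, -1}" "d \<in> {1, -1}"
      using kl by (auto simp: set_ks k l)
    have "x \<in> {real i, real i + 1} \<and> x \<in> {real j, real j + 1} \<and> sin (x * pi) = 0"
      if x: "x \<in> {real i..real i + 1}" "x \<in> {real j..real j + 1}"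
        and eq: "c * sin (x * pi) = d * sin (x * pi)" for x
    proof -
      have "x \<in> \<int>"
      proof (cases "i = j")
        case True
        then have "c \<noteq> d"
          using kl by (auto simp: k l)
        then show ?thesis
          using eq by (auto simp flip: sin_times_pi_eq_0)
      next
        case False
        then have "real i + 1 \<le> real j \<or> real j + 1 \<le> real i"
          by linarith
        then have "x = real i \<or> x = real j"
          using x unfolding atLeastAtMost_iff by argo
        then show ?thesis
          by auto
      qed
      then obtain m where m: "x = real_of_int m"
        by (auto elim: Ints_cases)
      have "m = int i \<or> m = int i + 1" "m = int j \<or> m = int j + 1"
        using x unfolding m atLeastAtMost_iff by linarith+
      then show ?thesis
        unfolding m by (auto simp: int0)
    qed
    then show ?thesis
      unfolding k l img ends by (fastforce simp: sine_curve_def)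
  qed
  then have inter: "\<forall>i < length (map e ks). \<forall>j < length (map e ks). i \<noteq> j \<longrightarrow>
      path_image (map e ks ! i) \<inter> path_image (map e ks ! j) \<subseteq>
      {pathstart (map e ks ! i), pathfinish (map e ks ! i)} \<inter>
      {pathstart (map e ks ! j), pathfinish (map e ks ! j)}"
    using dist_ks by (simp add: nth_eq_iff_index_eq)
  have conn: "connected (circle_chain M)"
  proof -
    have "pt 0 0 \<in> sine_curve {0..real M} 1 \<inter> sine_curve {0..real M} (-1)"
      by simp
    then have "sine_curve {0..real M} 1 \<inter> sine_curve {0..real M} (-1) \<noteq> {}"
      by blast
    then show ?thesis
      unfolding circle_chain_def
      by (rule connected_Un[OF connected_sine_curve[OF connected_Icc] connected_sine_curve[OF connected_Icc]])
  qed
  have ne: "map e ks \<noteq> []"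
  proof -
    have "(0, 1) \<in> set ks"
      using assms by (simp add: set_ks)
    then show ?thesis
      by fastforce
  qed
  show ?thesis
    unfolding topological_graph_def
  proof (intro conjI)
    show "\<exists>gs :: (real \<Rightarrow> real^3) list. gs \<noteq> [] \<and> (\<forall>g \<in> set gs. arc g) \<and>
        circle_chain M = (\<Union>g \<in> set gs. path_image g) \<and>
        (\<forall>i < length gs. \<forall>j < length gs. i \<noteq> j \<longrightarrow>
           path_image (gs ! i) \<inter> path_image (gs ! j) \<subseteq>
             {pathstart (gs ! i), pathfinish (gs ! i)} \<inter> {pathstart (gs ! j), pathfinish (gs ! j)})"
      by (rule exI[of _ "map e ks"], rule conjI[OF ne conjI[OF arcs conjI[OF union inter]]])
  qed (rule compact_circle_chain conn)+
qed

text \<open>A point slides along its own curve while its abscissa changes by \<open>h\<close>. Where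
  the curves meet, the sign \<open>1\<close> is a mere convention: if \<open>h\<close> maps integers
  to integers, the sine vanishes there before and after the move.\<close>

definition lift :: "(real \<Rightarrow> real) \<Rightarrow> nat \<Rightarrow> real^3 \<Rightarrow> real^3" where
  "lift h M z = pt (h (z $ 1))
     ((if z \<in> sine_curve {0..real M} 1 then 1 else -1) * sin (h (z $ 1) * pi))"

lemma lift_pt:
  assumes "\<And>x. \<lbrakk>x \<in> {0..real M}; x \<in> \<int>\<rbrakk> \<Longrightarrow> h x \<in> \<int>"
    and "x \<in> {0..real M}" "c = 1 \<or> c = -1"
  shows "lift h M (pt x (c * sin (x * pi))) = pt (h x) (c * sin (h x * pi))"
proof (cases "x \<in> \<int>")
  case True
  then have "sin (h x * pi) = 0"
    using assms by (simp add: sin_times_pi_eq_0)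
  then show ?thesis
    by (simp add: lift_def)
next
  case False
  then have "sin (x * pi) \<noteq> 0"
    by (simp add: sin_times_pi_eq_0)
  then show ?thesis
    using assms(2,3) by (auto simp: lift_def)
qed

text \<open>On each of the two closed curves \<open>lift\<close> has an explicit continuous formula
  with a fixed sign, and the two pieces are pasted. Lifting the inverse map gives the
  inverse.\<close>

lemma homeomorphism_lift:
  assumes hom: "homeomorphism {0..real M} {0..real M} h k"
    and h: "\<And>x. \<lbrakk>x \<in> {0..real M}; x \<in> \<int>\<rbrakk> \<Longrightarrow> h x \<in> \<int>"
    and k: "\<And>x. \<lbrakk>x \<in> {0..real M}; x \<in> \<int>\<rbrakk> \<Longrightarrow> k x \<in> \<int>"
  shows "homeomorphism (circle_chain M) (circle_chain M) (lift h M) (lift k M)"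
proof -
  have cont: "continuous_on (circle_chain M) (lift h M)"
    if "homeomorphism {0..real M} {0..real M} h k"
      and h: "\<And>x. \<lbrakk>x \<in> {0..real M}; x \<in> \<int>\<rbrakk> \<Longrightarrow> h x \<in> \<int>" for h k
    unfolding circle_chain_def
  proof (rule continuous_on_closed_Un)
    have "continuous_on (sine_curve {0..real M} c) (lift h M)" if c: "c = 1 \<or> c = -1" for c
    proof (rule continuous_on_cong[THEN iffD2, OF refl])
      show "lift h M z = pt (h (z $ 1)) (c * sin (h (z $ 1) * pi))"
        if "z \<in> sine_curve {0..real M} c" for z
        using that lift_pt[where h = h, OF h _ c] by (auto simp: sine_curve_def)
      have "continuous_on {0..real M} h"
        using \<open>homeomorphism _ _ h k\<close> by (simp add: homeomorphism_def)
      then have "continuous_on (sine_curve {0..real M} c) (\<lambda>z. h (z $ 1))"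
        by (rule continuous_on_compose2) (auto simp: sine_curve_def intro!: continuous_intros)
      then show "continuous_on (sine_curve {0..real M} c)
          (\<lambda>z. pt (h (z $ 1)) (c * sin (h (z $ 1) * pi)))"
        by (intro continuous_intros)
    qed
    then show "continuous_on (sine_curve {0..real M} 1) (lift h M)"
      "continuous_on (sine_curve {0..real M} (-1)) (lift h M)"
      by auto
  qed (auto intro!: compact_imp_closed compact_sine_curve)
  have inverse: "lift h M z \<in> circle_chain M" "lift k M (lift h M z) = z"
    if zA: "z \<in> circle_chain M" and hom: "homeomorphism {0..real M} {0..real M} h k"
      and hk: "\<And>x. \<lbrakk>x \<in> {0..real M}; x \<in> \<int>\<rbrakk> \<Longrightarrow> h x \<in> \<int>"
        "\<And>x. \<lbrakk>x \<in> {0..real M}; x \<in> \<int>\<rbrakk> \<Longrightarrow> k x \<in> \<int>" for z h k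
  proof -
    obtain x c where z: "z = pt x (c * sin (x * pi))" "x \<in> {0..real M}" "c = 1 \<or> c = -1"
      using zA by (rule circle_chainE_sine)
    have x: "h x \<in> {0..real M}" "k (h x) = x"
      using z(2) hom by (auto simp: homeomorphism_def)
    have lz: "lift h M z = pt (h x) (c * sin (h x * pi))"
      unfolding z(1) using hk(1) z(2,3) by (rule lift_pt)
    show "lift h M z \<in> circle_chain M"
      unfolding lz using x(1) z(3) by (auto simp: abs_mult)
    have "lift k M (pt (h x) (c * sin (h x * pi))) = pt (k (h x)) (c * sin (k (h x) * pi))"
      using hk(2) x(1) z(3) by (rule lift_pt)
    then show "lift k M (lift h M z) = z"
      unfolding lz by (simp add: x(2) z(1))
  qed
  show ?thesis
    using cont[OF hom h] cont[OF homeomorphism_symD[OF hom] k]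
      inverse[OF _ hom h k] inverse[OF _ homeomorphism_symD[OF hom] k h]
    by (intro homeomorphismI) auto
qed

text \<open>Near the tip \<open>pt 0 0\<close> the second coordinate is a chart.\<close>
definition tip_map :: "real \<Rightarrow> (real \<Rightarrow> real) \<Rightarrow> real^3 \<Rightarrow> real^3" where
  "tip_map c h z = (if z $ 1 \<le> c then pt (arcsin \<bar>h (z $ 2)\<bar> / pi) (h (z $ 2)) else z)"

lemma arcsin_sin_first_quadrant: "\<lbrakk>0 \<le> t; t \<le> pi / 2\<rbrakk> \<Longrightarrow> arcsin (sin t) = t"
  by (rule arcsin_sin) auto

text \<open>On \<open>[0, 1/2]\<close> the function \<open>sin (x * pi)\<close> increases from 0 and
  is inverted by \<open>arcsin\<close> divided by \<open>pi\<close>, so the second coordinate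
  determines the point.\<close>

lemma tip_chart:
  assumes c: "0 < c" "c \<le> 1/2"
  shows "x \<in> {0..c} \<and> \<bar>y\<bar> = \<bar>sin (x * pi)\<bar> \<longleftrightarrow> \<bar>y\<bar> \<le> sin (c * pi) \<and> x = arcsin \<bar>y\<bar> / pi"
proof -
  have cpi: "0 < c * pi" "c * pi \<le> pi / 2"
    using c by auto
  show ?thesis
  proof (intro iffI conjI)
    assume A: "x \<in> {0..c} \<and> \<bar>y\<bar> = \<bar>sin (x * pi)\<bar>"
    then have x: "0 \<le> x * pi" "x * pi \<le> c * pi"
      by auto
    then have y: "\<bar>y\<bar> = sin (x * pi)"
      using A cpi by (simp add: sin_ge_zero)
    show "\<bar>y\<bar> \<le> sin (c * pi)"
      unfolding y using x cpi order_trans[OF _ x(1), of "- (pi / 2)"] by (intro sin_monotone_2pi_le) simp_all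
    show "x = arcsin \<bar>y\<bar> / pi"
    proof -
      have "arcsin (sin (x * pi)) = x * pi"
        using x(1) order_trans[OF x(2) cpi(2)] by (rule arcsin_sin_first_quadrant)
      then show ?thesis
        by (simp add: y)
    qed
  next
    assume A: "\<bar>y\<bar> \<le> sin (c * pi) \<and> x = arcsin \<bar>y\<bar> / pi"
    then have y1: "\<bar>y\<bar> \<le> 1"
      using sin_le_one order_trans by blast
    have "arcsin \<bar>y\<bar> \<le> arcsin (sin (c * pi))"
      using A by (intro arcsin_le_arcsin) auto
    also have "\<dots> = c * pi"
      using cpi by (intro arcsin_sin_first_quadrant) simp_all
    finally have "arcsin \<bar>y\<bar> / pi \<le> c"
      by (simp add: divide_simps)
    moreover have "0 \<le> arcsin \<bar>y\<bar>"
      using arcsin_le_arcsin[of 0 "\<bar>y\<bar>"] y1 by simp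
    ultimately show "x \<in> {0..c}"
      using A by simp
    show "\<bar>y\<bar> = \<bar>sin (x * pi)\<bar>"
      using A y1 by simp
  qed
qed

text \<open>The map \<open>h\<close> is transported through the chart and extended by the identity;
  both agree on the fibre over \<open>c\<close> because \<open>h\<close> fixes \<open>b\<close> and
  \<open>-b\<close>. Such maps can move the tip off itself, whereas a lift sends tips to
  tips.\<close>

lemma homeomorphism_tip_map:
  fixes c M
  defines "b \<equiv> sin (c * pi)"
  assumes c: "0 < c" "c \<le> 1/2" and M: "M > 0"
    and hom: "homeomorphism {-b..b} {-b..b} h k"
    and bd: "h b = b" "h (-b) = -b" "k b = b" "k (-b) = -b"
  shows "homeomorphism (circle_chain M) (circle_chain M) (tip_map c h) (tip_map c k)"
proof -
  let ?A = "circle_chain M"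
  have cM: "c \<le> real M"
    using c M by linarith
  have arcsin_b: "arcsin b = c * pi"
  proof -
    have "c * pi \<le> pi / 2" "0 < c * pi"
      using c by auto
    then show ?thesis
      unfolding b_def by (intro arcsin_sin_first_quadrant) simp_all
  qed
  have b: "0 < b" "b \<le> 1"
    using c sin_gt_zero[of "c * pi"] by (auto simp: b_def)
  have chart: "pt x y \<in> ?A \<and> x \<le> c \<longleftrightarrow> y \<in> {-b..b} \<and> x = arcsin \<bar>y\<bar> / pi" for x y
    using tip_chart[OF c, of x y] cM by (auto simp: b_def)
  have map: "tip_map c h (pt x y) = pt (arcsin \<bar>h y\<bar> / pi) (h y)" if "x \<le> c" for h x y
    using that by (simp add: tip_map_def)
  have cont: "continuous_on ?A (tip_map c h)"
    if hom: "homeomorphism {-b..b} {-b..b} h k" and hb: "h b = b" "h (-b) = -b" for h k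
    unfolding tip_map_def
  proof (rule continuous_on_cases_le)
    let ?S = "{z \<in> ?A. z $ 1 \<le> c}"
    have S: "z $ 2 \<in> {-b..b}" if "z \<in> ?S" for z
    proof -
      obtain x y where "z = pt x y"
        using \<open>z \<in> ?S\<close> by (auto elim: circle_chainE)
      then show ?thesis
        using \<open>z \<in> ?S\<close> chart[of x y] by simp
    qed
    have "continuous_on {-b..b} h"
      using hom by (simp add: homeomorphism_def)
    then have hc: "continuous_on ?S (\<lambda>z. h (z $ 2))"
      by (rule continuous_on_compose2) (use S in \<open>auto intro!: continuous_intros\<close>)
    have "\<bar>h (z $ 2)\<bar> \<le> 1" if "z \<in> ?S" for z
    proof -
      have "h (z $ 2) \<in> {-b..b}"
        using hom S[OF that] by (auto simp: homeomorphism_def)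
      then show ?thesis
        using b by auto
    qed
    then show "continuous_on ?S (\<lambda>z. pt (arcsin \<bar>h (z $ 2)\<bar> / pi) (h (z $ 2)))"
      using hc by (intro continuous_intros) fastforce+
    show "pt (arcsin \<bar>h (z $ 2)\<bar> / pi) (h (z $ 2)) = z" if "z \<in> ?A" "z $ 1 = c" for z
    proof -
      obtain x y where z: "z = pt x y"
        using \<open>z \<in> ?A\<close> by (rule circle_chainE)
      have "pt c y \<in> ?A"
        using that z by simp
      then have "y = b \<or> y = -b"
        by (auto simp: b_def abs_eq_iff)
      then show ?thesis
      proof
        assume "y = b"
        then show ?thesis
          using that(2) b by (simp add: z hb(1) arcsin_b)
      next
        assume "y = - b"
        then show ?thesis
          using that(2) b by (simp add: z hb(2) arcsin_b)
      qed
    qed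
  qed (auto intro!: continuous_intros)
  have inverse: "tip_map c h z \<in> ?A \<and> tip_map c k (tip_map c h z) = z"
    if hom: "homeomorphism {-b..b} {-b..b} h k" and z: "z \<in> ?A" for h k z
  proof (cases "z $ 1 \<le> c")
    case False
    then show ?thesis
      using z by (simp add: tip_map_def)
  next
    case True
    obtain x y where xy: "z = pt x y"
      using z by (rule circle_chainE)
    have y: "y \<in> {-b..b}" "x = arcsin \<bar>y\<bar> / pi"
      using True z chart unfolding xy by auto
    have hy: "h y \<in> {-b..b}" "k (h y) = y"
      using hom y by (auto simp: homeomorphism_def)
    then have "pt (arcsin \<bar>h y\<bar> / pi) (h y) \<in> ?A \<and> arcsin \<bar>h y\<bar> / pi \<le> c"
      using chart by blast
    then show ?thesis
      using True y hy by (simp add: xy map)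
  qed
  show ?thesis
    using cont[OF hom bd(1,2)] cont[OF homeomorphism_symD[OF hom] bd(3,4)]
      inverse[OF hom] inverse[OF homeomorphism_symD[OF hom]]
    by (intro homeomorphismI) auto
qed

section \<open>Rigidity of the chain\<close>

text \<open>For \<open>0 < i < M\<close> these are the touching points; \<open>vertex 0\<close> and
  \<open>vertex M\<close> are the two tips of the chain.\<close>

definition vertex :: "nat \<Rightarrow> real^3" where
  "vertex i = pt (real i) 0"

definition left_part :: "nat \<Rightarrow> real \<Rightarrow> (real^3) set" where
  "left_part M a = {z \<in> circle_chain M. z $ 1 < a}"

definition right_part :: "nat \<Rightarrow> real \<Rightarrow> (real^3) set" where
  "right_part M a = {z \<in> circle_chain M. a < z $ 1}"

lemma vertex_nth [simp]: "vertex i $ 1 = real i"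
  by (simp add: vertex_def)

lemma vertex_eq_iff [simp]: "vertex i = vertex j \<longleftrightarrow> i = j"
  by (simp add: vertex_def)

lemma vertex_in_circle_chain [simp]: "vertex i \<in> circle_chain M \<longleftrightarrow> i \<le> M"
  by (simp add: vertex_def)

lemma circle_chain_eq_vertex:
  assumes "z \<in> circle_chain M" "z $ 1 = real i"
  shows "z = vertex i"
  using assms by (auto elim!: circle_chainE simp: vertex_def)

lemma circle_chain_diff_vertex:
  "circle_chain M - {vertex i} = left_part M (real i) \<union> right_part M (real i)"
proof -
  have "z = vertex i \<longleftrightarrow> z $ 1 = real i" if "z \<in> circle_chain M" for z
    using that circle_chain_eq_vertex by auto
  then show ?thesis
    unfolding left_part_def right_part_def by force
qed

lemma connected_left_part:
  assumes "0 < a" "a \<le> real M"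
  shows "connected (left_part M a)"
proof -
  have "left_part M a = sine_curve {0..<a} 1 \<union> sine_curve {0..<a} (-1)"
    using assms by (auto simp: left_part_def circle_chain_def sine_curve_def)
  moreover have "pt 0 0 \<in> sine_curve {0..<a} 1 \<inter> sine_curve {0..<a} (-1)"
    using assms by simp
  ultimately show ?thesis
    by (metis connected_Un connected_sine_curve connected_Ico empty_iff)
qed

lemma connected_right_part:
  assumes "0 \<le> a" "a < real M"
  shows "connected (right_part M a)"
proof -
  have "right_part M a = sine_curve {a<..real M} 1 \<union> sine_curve {a<..real M} (-1)"
    using assms by (auto simp: right_part_def circle_chain_def sine_curve_def)
  moreover have "pt (real M) 0 \<in> sine_curve {a<..real M} 1 \<inter> sine_curve {a<..real M} (-1)"
    using assms by simp
  ultimately show ?thesis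
    by (metis connected_Un connected_sine_curve connected_Ioc empty_iff)
qed

text \<open>At a tip, one side is empty and the other connected. Any other point considered here
  lies on only one of the two curves, and the intact curve joins the two remaining pieces at the
  tips.\<close>

lemma connected_circle_chain_minus_point:
  assumes "M > 0" "z \<in> circle_chain M" "z \<notin> vertex ` {1..<M}"
  shows "connected (circle_chain M - {z})"
proof -
  obtain x c where z: "z = pt x (c * sin (x * pi))" "x \<in> {0..real M}" "c = 1 \<or> c = -1"
    using assms(2) by (rule circle_chainE_sine)
  show ?thesis
  proof (cases "x \<in> \<int>")
    case True
    then obtain m where m: "x = real m"
      using z(2) by (auto elim!: Ints_cases) (metis of_nat_nat of_int_of_nat_eq)
    then have zm: "z = vertex m"
      using assms(2) z(1) by (intro circle_chain_eq_vertex) auto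
    then have "m = 0 \<or> m = M"
      using z(2) m assms(3) by auto
    then show ?thesis
    proof
      assume [simp]: "m = 0"
      have "left_part M (real m) = {}"
        by (auto simp: left_part_def elim!: circle_chainE)
      then show ?thesis
        using connected_right_part[of 0 M] assms(1) unfolding zm circle_chain_diff_vertex by simp
    next
      assume [simp]: "m = M"
      have "right_part M (real m) = {}"
        by (auto simp: right_part_def elim!: circle_chainE)
      then show ?thesis
        using connected_left_part[of "real M" M] assms(1)
        unfolding zm circle_chain_diff_vertex by simp
    qed
  next
    case False
    then have s: "sin (x * pi) \<noteq> 0"
      by (simp add: sin_times_pi_eq_0)
    have "x \<noteq> 0" "x \<noteq> real M"
      using False by auto
    then have x: "0 < x" "x < real M"
      using z(2) by simp_all
    have "circle_chain M = sine_curve {0..real M} c \<union> sine_curve {0..real M} (- c)"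
      using z(3) by (auto simp: circle_chain_def)
    moreover have "z \<notin> sine_curve {0..real M} (- c)"
      using s z(3) by (auto simp: z(1))
    moreover have "sine_curve {0..real M} c - {z} = sine_curve {0..<x} c \<union> sine_curve {x<..real M} c"
    proof -
      have "{0..real M} = insert x ({0..<x} \<union> {x<..real M})"
        using x by auto
      then have "sine_curve {0..real M} c = insert z (sine_curve {0..<x} c \<union> sine_curve {x<..real M} c)"
        by (simp only: sine_curve_def image_insert image_Un z(1))
      moreover have "z \<notin> sine_curve {0..<x} c \<union> sine_curve {x<..real M} c"
        by (simp add: z(1))
      ultimately show ?thesis
        by blast
    qed
    ultimately have eq: "circle_chain M - {z} =
        (sine_curve {0..real M} (- c) \<union> sine_curve {0..<x} c) \<union> sine_curve {x<..real M} c"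
      by blast
    have "pt 0 0 \<in> sine_curve {0..real M} (- c) \<inter> sine_curve {0..<x} c"
      using x by simp
    then have "sine_curve {0..real M} (- c) \<inter> sine_curve {0..<x} c \<noteq> {}"
      by blast
    then have "connected (sine_curve {0..real M} (- c) \<union> sine_curve {0..<x} c)"
      by (intro connected_Un connected_sine_curve connected_Icc connected_Ico)
    moreover have "pt (real M) 0 \<in>
        (sine_curve {0..real M} (- c) \<union> sine_curve {0..<x} c) \<inter> sine_curve {x<..real M} c"
      using x by simp
    then have "(sine_curve {0..real M} (- c) \<union> sine_curve {0..<x} c) \<inter> sine_curve {x<..real M} c \<noteq> {}"
      by blast
    ultimately show ?thesis
      unfolding eq by (intro connected_Un[OF _ connected_sine_curve[OF connected_Ioc]])
  qed
qed

lemma open_nth_less: "open {z :: real^3. z $ 1 < a}"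
  and open_nth_greater: "open {z :: real^3. a < z $ 1}"
  by (intro open_Collect_less continuous_intros)+

text \<open>The two sides of a vertex lie in disjoint open half-spaces, so a connected set avoiding
  the vertex cannot meet both.\<close>

lemma connected_diff_vertexE:
  assumes "connected S" "S \<subseteq> circle_chain M - {vertex i}"
  obtains "S \<subseteq> left_part M (real i)" | "S \<subseteq> right_part M (real i)"
proof -
  let ?U = "{z :: real^3. z $ 1 < real i}" and ?V = "{z :: real^3. real i < z $ 1}"
  have S: "S \<subseteq> left_part M (real i) \<union> right_part M (real i)"
    using assms(2) by (simp add: circle_chain_diff_vertex)
  have "?U \<inter> ?V \<inter> S = {}" "S \<subseteq> ?U \<union> ?V"
    using S by (auto simp: left_part_def right_part_def)
  then have "?U \<inter> S = {} \<or> ?V \<inter> S = {}"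
    by (intro connectedD[OF assms(1) open_nth_less open_nth_greater])
  then have "S \<subseteq> left_part M (real i) \<or> S \<subseteq> right_part M (real i)"
    using S by (fastforce simp: left_part_def right_part_def)
  then show ?thesis
    using that by blast
qed

lemma parts_disjoint: "left_part M a \<inter> right_part M a = {}"
  by (auto simp: left_part_def right_part_def)

lemma parts_nonempty:
  assumes "i \<in> {1..<M}"
  shows "left_part M (real i) \<noteq> {}" "right_part M (real i) \<noteq> {}"
proof -
  have "vertex 0 \<in> left_part M (real i)" "vertex M \<in> right_part M (real i)"
    using assms by (auto simp: left_part_def right_part_def)
  then show "left_part M (real i) \<noteq> {}" "right_part M (real i) \<noteq> {}"
    by blast+
qed

lemma not_connected_circle_chain_minus_vertex:
  assumes "i \<in> {1..<M}"
  shows "\<not> connected (circle_chain M - {vertex i})"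
proof
  assume "connected (circle_chain M - {vertex i})"
  then show False
    using parts_nonempty[OF assms] parts_disjoint[of M "real i"]
    by (rule_tac connected_diff_vertexE[OF _ order_refl]) (auto simp: circle_chain_diff_vertex)
qed

section \<open>Action of homeomorphisms on the cut points\<close>

lemma Homeo_continuous_on: "f \<in> Homeo A \<Longrightarrow> continuous_on A f"
  by (auto simp: Homeo_def homeomorphism_def)

lemma Homeo_inj: "f \<in> Homeo A \<Longrightarrow> inj f"
  by (simp add: Homeo_inv(2) bij_is_inj)

lemma Homeo_image_minus: "f \<in> Homeo A \<Longrightarrow> f ` (A - {z}) = A - {f z}"
  by (simp add: image_set_diff Homeo_inj Homeo_inv(3))

text \<open>The vertices strictly between the tips are exactly the points whose removal disconnects
  the chain. If the image of one were not a cut point, pulling its connected complement back by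
  \<open>inv f\<close> would give a contradiction.\<close>

lemma Homeo_vertices_subset:
  assumes f: "f \<in> Homeo (circle_chain M)"
  shows "f ` vertex ` {1..<M} \<subseteq> vertex ` {1..<M}"
proof clarify
  fix i assume i: "i \<in> {1..<M}"
  let ?A = "circle_chain M"
  show "f (vertex i) \<in> vertex ` {1..<M}"
  proof (rule ccontr)
    assume nv: "f (vertex i) \<notin> vertex ` {1..<M}"
    have "f (vertex i) \<in> ?A"
      using i Homeo_inv(3)[OF f] by (metis imageI vertex_in_circle_chain atLeastLessThan_iff less_imp_le)
    then have "connected (?A - {f (vertex i)})"
      using nv i by (intro connected_circle_chain_minus_point) auto
    moreover have "continuous_on (?A - {f (vertex i)}) (inv f)"
      using Homeo_continuous_on[OF Homeo_inv(1)[OF f]] continuous_on_subset by blast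
    ultimately have "connected (inv f ` (?A - {f (vertex i)}))"
      by (rule connected_continuous_image[rotated])
    then show False
      using not_connected_circle_chain_minus_vertex[OF i] Homeo_inj[OF f]
      by (simp add: Homeo_image_minus[OF Homeo_inv(1)[OF f]])
  qed
qed

lemma Homeo_vertices:
  assumes f: "f \<in> Homeo (circle_chain M)"
  shows "f ` vertex ` {1..<M} = vertex ` {1..<M}"
proof
  show "vertex ` {1..<M} \<subseteq> f ` vertex ` {1..<M}"
  proof
    fix z assume "z \<in> vertex ` {1..<M}"
    then have "inv f z \<in> vertex ` {1..<M}"
      using Homeo_vertices_subset[OF Homeo_inv(1)[OF f]] by blast
    moreover have "f (inv f z) = z"
      using Homeo_inv(2)[OF f] by (simp add: bij_is_surj surj_f_inv_f)
    ultimately show "z \<in> f ` vertex ` {1..<M}"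
      by (metis imageI)
  qed
qed (rule Homeo_vertices_subset[OF f])

lemma card_vertices_left_part:
  assumes "i \<le> M"
  shows "card (vertex ` {1..<M} \<inter> left_part M (real i)) = i - 1"
proof -
  have "vertex ` {1..<M} \<inter> left_part M (real i) = vertex ` {1..<i}"
    using assms by (auto simp: left_part_def)
  then show ?thesis
    by (simp add: card_image inj_on_def)
qed

lemma card_vertices_right_part:
  "card (vertex ` {1..<M} \<inter> right_part M (real i)) = M - Suc i"
proof -
  have "vertex ` {1..<M} \<inter> right_part M (real i) = vertex ` {Suc i..<M}"
    by (auto simp: right_part_def)
  then show ?thesis
    by (simp add: card_image inj_on_def)
qed

text \<open>Used with \<open>U\<close>, \<open>W\<close> the images of the two sides of a vertex and
  \<open>U'\<close>, \<open>W'\<close> the two sides of the image vertex.\<close>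

lemma partition_eq_or_swap:
  assumes "U \<subseteq> U' \<or> U \<subseteq> W'" "W \<subseteq> U' \<or> W \<subseteq> W'" "U \<union> W = U' \<union> W'"
    and "U' \<inter> W' = {}" "U' \<noteq> {}" "W' \<noteq> {}"
  shows "U = U' \<and> W = W' \<or> U = W' \<and> W = U'"
  using assms by blast

text \<open>The two sides of a vertex are told apart, up to reflection, by how many vertices they contain.\<close>
lemma Homeo_vertex_cases:
  assumes f: "f \<in> Homeo (circle_chain M)" and i: "i \<in> {1..<M}"
  obtains "f (vertex i) = vertex i"
      "f ` left_part M (real i) \<subseteq> left_part M (real i)"
      "f ` right_part M (real i) \<subseteq> right_part M (real i)"
    | "f (vertex i) = vertex (M - i)"
      "f ` left_part M (real i) \<subseteq> right_part M (real (M - i))"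
      "f ` right_part M (real i) \<subseteq> left_part M (real (M - i))"
proof -
  let ?A = "circle_chain M" and ?V = "vertex ` {1..<M}"
  let ?L = "\<lambda>i. left_part M (real i)" and ?R = "\<lambda>i. right_part M (real i)"
  have "f (vertex i) \<in> ?V"
    using Homeo_vertices_subset[OF f] i by blast
  then obtain j where j: "f (vertex i) = vertex j" "j \<in> {1..<M}"
    by blast
  have un: "f ` ?L i \<union> f ` ?R i = ?L j \<union> ?R j"
    using Homeo_image_minus[OF f, of "vertex i"]
    by (simp add: circle_chain_diff_vertex j(1) image_Un)
  have side: "f ` S \<subseteq> ?L j \<or> f ` S \<subseteq> ?R j" if S: "S = ?L i \<or> S = ?R i" for S
  proof -
    have "connected S"
      using S i connected_left_part[of "real i" M] connected_right_part[of "real i" M] by auto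
    moreover have "continuous_on S f"
      using S by (intro continuous_on_subset[OF Homeo_continuous_on[OF f]])
        (auto simp: left_part_def right_part_def)
    ultimately have "connected (f ` S)"
      by (intro connected_continuous_image)
    moreover have "f ` S \<subseteq> ?A - {vertex j}"
      using un S by (auto simp: circle_chain_diff_vertex)
    ultimately show ?thesis
      by (rule connected_diff_vertexE) auto
  qed
  \<comment> \<open>A homeomorphism permutes the cut points, so a set and its image contain equally
    many of them.\<close>
  have count: "card (?V \<inter> f ` S) = card (?V \<inter> S)" for S
  proof -
    have "?V \<inter> f ` S = f ` ?V \<inter> f ` S"
      by (simp only: Homeo_vertices[OF f])
    also have "\<dots> = f ` (?V \<inter> S)"
      by (simp add: image_Int Homeo_inj[OF f])
    finally show ?thesis
      using Homeo_inj[OF f] by (simp add: card_image inj_on_subset)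
  qed
  note ne = parts_nonempty[OF j(2)] and disj = parts_disjoint[of M "real j"]
  have "f ` ?L i = ?L j \<and> f ` ?R i = ?R j \<or> f ` ?L i = ?R j \<and> f ` ?R i = ?L j"
    by (rule partition_eq_or_swap[OF side side un disj ne]) simp_all
  then consider (same) "f ` ?L i = ?L j" "f ` ?R i = ?R j"
    | (swap) "f ` ?L i = ?R j" "f ` ?R i = ?L j"
    by blast
  then show ?thesis
  proof cases
    case same
    then have "i - 1 = j - 1"
      using count[of "?L i"] card_vertices_left_part[of i M] card_vertices_left_part[of j M] i j(2)
      by simp
    then have "i = j"
      using i j(2) by auto
    then show ?thesis
      using same j(1) by (intro that(1)) auto
  next
    case swap
    then have "i - 1 = M - Suc j"
      using count[of "?L i"] card_vertices_left_part[of i M] card_vertices_right_part[of M j] i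
      by simp
    then have "j = M - i"
      using i j(2) by auto
    then show ?thesis
      using swap j(1) by (intro that(2)) auto
  qed
qed

text \<open>This is the abscissa after folding the chain by the reflection; on the chain it ranges
  over \<open>[0, M/2]\<close>.\<close>

definition depth :: "nat \<Rightarrow> real^3 \<Rightarrow> real" where
  "depth M z = min (z $ 1) (real M - z $ 1)"

text \<open>Depth below \<open>i\<close> describes the two outer pieces cut off by
  \<open>vertex i\<close> and \<open>vertex (M - i)\<close>, and depth \<open>i\<close> describes
  these vertices themselves, which coincide if \<open>2 * i = M\<close>.\<close>

lemma Homeo_depth:
  assumes f: "f \<in> Homeo (circle_chain M)" and z: "z \<in> circle_chain M"
    and i: "1 \<le> i" "2 * i \<le> M"
  shows "depth M z < real i \<Longrightarrow> depth M (f z) < real i"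
    and "depth M z = real i \<Longrightarrow> depth M (f z) = real i"
proof -
  have iM: "i \<in> {1..<M}" "M - i \<in> {1..<M}" and MM: "M - (M - i) = i" and r: "real (M - i) = real M - real i"
    using i by auto
  have less: "depth M w < real i \<longleftrightarrow> w \<in> left_part M (real i) \<union> right_part M (real (M - i))"
    if "w \<in> circle_chain M" for w
    using that r by (auto simp: depth_def left_part_def right_part_def)
  have eq: "depth M w = real i \<longleftrightarrow> w = vertex i \<or> w = vertex (M - i)"
    if "w \<in> circle_chain M" for w
  proof
    assume "depth M w = real i"
    then have "w $ 1 = real i \<or> w $ 1 = real (M - i)"
      using r by (auto simp: depth_def min_def split: if_splits)
    then show "w = vertex i \<or> w = vertex (M - i)"
      using that circle_chain_eq_vertex by blast
  next
    assume "w = vertex i \<or> w = vertex (M - i)"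
    then show "depth M w = real i"
      using i r by (auto simp: depth_def min_def)
  qed
  have fz: "f z \<in> circle_chain M"
    using z Homeo_inv(3)[OF f] by blast
  \<comment> \<open>Each of the two vertices is either fixed or reflected; in all four combinations
    the outer pieces stay inside their union.\<close>
  have "f ` (left_part M (real i) \<union> right_part M (real (M - i)))
      \<subseteq> left_part M (real i) \<union> right_part M (real (M - i))"
    by (rule Homeo_vertex_cases[OF f iM(1)]; rule Homeo_vertex_cases[OF f iM(2)];
        unfold MM image_Un; blast)
  then show "depth M z < real i \<Longrightarrow> depth M (f z) < real i"
    unfolding less[OF z] less[OF fz] by blast
  have "f (vertex i) \<in> {vertex i, vertex (M - i)}" "f (vertex (M - i)) \<in> {vertex i, vertex (M - i)}"
    by (rule Homeo_vertex_cases[OF f iM(1)]; simp)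
      (rule Homeo_vertex_cases[OF f iM(2)]; simp add: MM)
  then show "depth M z = real i \<Longrightarrow> depth M (f z) = real i"
    unfolding eq[OF z] eq[OF fz] by auto
qed

lemma Homeo_depth_iff:
  assumes f: "f \<in> Homeo (circle_chain M)" and z: "z \<in> circle_chain M"
    and i: "1 \<le> i" "2 * i \<le> M"
  shows "depth M (f z) < real i \<longleftrightarrow> depth M z < real i"
    and "depth M (f z) = real i \<longleftrightarrow> depth M z = real i"
proof -
  have "f z \<in> circle_chain M" "inv f (f z) = z"
    using z Homeo_inv(3)[OF f] Homeo_inj[OF f] by auto
  then show "depth M (f z) < real i \<longleftrightarrow> depth M z < real i"
    and "depth M (f z) = real i \<longleftrightarrow> depth M z = real i"
    using Homeo_depth[OF f z i] Homeo_depth[OF Homeo_inv(1)[OF f], of "f z" i] i by auto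
qed

section \<open>Marked chains\<close>

text \<open>Special case of \<open>homeomorphism_moving_point\<close>: a nonempty open set of reals
  has the whole line as its affine hull.\<close>

lemma homeomorphism_moving_point_real:
  fixes S T :: "real set"
  assumes S: "open S" "connected S" "S \<subseteq> T" and ab: "a \<in> S" "b \<in> S"
  obtains h k where "homeomorphism T T h k" "h a = b"
    "\<And>x. x \<notin> S \<Longrightarrow> h x = x" "\<And>x. x \<notin> S \<Longrightarrow> k x = x"
proof -
  have "affine hull S = UNIV"
    using S(1) ab(1) by (intro affine_hull_open) auto
  then have ope: "openin (top_of_set (affine hull S)) S" and sub: "T \<subseteq> affine hull S"
    using S(1) by auto
  obtain h k where "homeomorphism T T h k" "h a = b" "{x. \<not> (h x = x \<and> k x = x)} \<subseteq> S"
    by (rule homeomorphism_moving_point[OF ope S(3) sub S(2) ab])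
  then show ?thesis
    by (intro that[of h k]) auto
qed

text \<open>The parameter \<open>e\<close> counts the extra marks in \<open>(0, 1/2)\<close>; the tips are marked iff \<open>q = 0\<close>.\<close>
locale marked_chain =
  fixes M e q :: nat
  assumes M_pos: "M > 0" and q_le: "q \<le> 1"
begin

abbreviation r :: nat where "r \<equiv> e + M div 2"

text \<open>The values are 0, then \<open>e\<close> equally spaced points, then the integers 1, 2,
  and so on. The denominator keeps the spaced points below \<open>1/2\<close>, hence below the fold
  point \<open>M/2\<close> even for \<open>M = 1\<close>.\<close>

definition t :: "nat \<Rightarrow> real" where
  "t i = (if i \<le> e then real i / (2 * real e + 2) else real i - real e)"

definition marks :: "real set" where "marks = t ` {q..r}"

text \<open>Marks get the labels \<open>0, \<dots>, r - q\<close> and gaps the larger ones, so that sublevel sets are closed.\<close>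
definition idx :: "real \<Rightarrow> nat" where "idx s = card {i \<in> {q..r}. t i < s}"

definition lab :: "real \<Rightarrow> nat" where "lab s = (if s \<in> marks then idx s else r + idx s)"

lemma t_0 [simp]: "t 0 = 0"
  by (simp add: t_def)

section \<open>Counting marks and gaps\<close>

lemma strict_mono_t: "strict_mono t"
  unfolding strict_mono_Suc_iff
proof
  fix i
  consider "Suc i \<le> e" | "i = e" | "e < i"
    by linarith
  then show "t i < t (Suc i)"
  proof cases
    case 2
    have "real e < 2 * real e + 2"
      by simp
    then show ?thesis
      using 2 by (simp add: t_def divide_simps)
  qed (simp_all add: t_def divide_simps)
qed

lemma t_less_iff [simp]: "t i < t j \<longleftrightarrow> i < j"
  using strict_mono_t by (rule strict_mono_less)

lemma t_eq_iff [simp]: "t i = t j \<longleftrightarrow> i = j"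
  using strict_mono_t by (rule strict_mono_eq)

lemma t_le_iff [simp]: "t i \<le> t j \<longleftrightarrow> i \<le> j"
  using strict_mono_t by (rule strict_mono_less_eq)

lemma t_nonneg [simp]: "0 \<le> t i"
  using t_le_iff[of 0 i] by simp

lemma t_add: "1 \<le> k \<Longrightarrow> t (e + k) = real k"
  by (simp add: t_def)

text \<open>For even \<open>M\<close> the fold point \<open>M/2\<close> is the last mark; for odd
  \<open>M\<close> it lies in one further gap beyond the last mark. This is the source of
  \<open>M mod 2\<close> below.\<close>

lemma t_r_even: "even M \<Longrightarrow> t r = real M / 2"
  using M_pos t_add[of "M div 2"] by (auto elim!: evenE)

lemma t_r_odd: "odd M \<Longrightarrow> t r < real M / 2"
proof (cases "M div 2 = 0")
  case True
  then have "t r = real e / (2 * real e + 2)"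
    by (simp add: t_def)
  also have "\<dots> < 1 / 2"
    by (simp add: divide_simps)
  finally show ?thesis
    using M_pos by simp
next
  case False
  assume "odd M"
  then show ?thesis
    using t_add[of "M div 2"] False by (auto elim!: oddE)
qed

lemma t_le_half: "i \<le> r \<Longrightarrow> t i \<le> real M / 2"
  using t_r_even t_r_odd t_le_iff[of i r] by (cases "even M") (metis order_trans order_less_imp_le)+

lemma idx_t: "i \<in> {q..r} \<Longrightarrow> idx (t i) = i - q"
proof -
  assume "i \<in> {q..r}"
  then have "{k \<in> {q..r}. t k < t i} = {q..<i}"
    by auto
  then show ?thesis
    by (simp add: idx_def)
qed

text \<open>The upper bound on \<open>s\<close> is conditional because there is no mark beyond
  \<open>t r\<close>; this covers the last gap too.\<close>

lemma idx_between:
  assumes "i \<le> r" "t i < s" "i < r \<Longrightarrow> s \<le> t (Suc i)"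
  shows "idx s = Suc i - q"
proof -
  have "t k < s \<longleftrightarrow> k \<le> i" if "k \<le> r" for k
  proof
    assume "k \<le> i"
    then have "t k \<le> t i"
      by simp
    then show "t k < s"
      using assms(2) by linarith
  next
    assume "t k < s"
    show "k \<le> i"
    proof (rule ccontr)
      assume "\<not> k \<le> i"
      then have "t (Suc i) \<le> t k" "i < r"
        using that by simp_all
      then show False
        using assms(3) \<open>t k < s\<close> by linarith
    qed
  qed
  then have "{k \<in> {q..r}. t k < s} = {q..i}"
    using assms(1) by auto
  then show ?thesis
    by (simp add: idx_def)
qed

text \<open>Since \<open>idx\<close> counts the marks strictly below \<open>s\<close>, at most
  \<open>m\<close> are counted iff mark number \<open>m\<close> (from zero), if there is one, is not
  below \<open>s\<close>. So sublevel sets of \<open>idx\<close> are closed half-lines or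
  everything.\<close>

lemma idx_le_iff: "idx s \<le> m \<longleftrightarrow> (q + m \<le> r \<longrightarrow> s \<le> t (q + m))"
proof
  assume L: "idx s \<le> m"
  show "q + m \<le> r \<longrightarrow> s \<le> t (q + m)"
  proof (rule impI, rule ccontr)
    assume qm: "q + m \<le> r" and "\<not> s \<le> t (q + m)"
    then have "t k < s" if "k \<le> q + m" for k
      using that t_le_iff[of k "q + m"] by linarith
    then have "{q..q + m} \<subseteq> {k \<in> {q..r}. t k < s}"
      using qm by auto
    then have "card {q..q + m} \<le> idx s"
      unfolding idx_def by (intro card_mono) auto
    then show False
      using L by simp
  qed
next
  assume R: "q + m \<le> r \<longrightarrow> s \<le> t (q + m)"
  have "{k \<in> {q..r}. t k < s} \<subseteq> {q..<q + m}"
  proof clarify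
    fix k assume k: "k \<in> {q..r}" "t k < s"
    have "k < q + m"
    proof (rule ccontr)
      assume "\<not> k < q + m"
      then have "q + m \<le> r" "t (q + m) \<le> t k"
        using k by auto
      then show False
        using R k by linarith
    qed
    then show "k \<in> {q..<q + m}"
      using k by simp
  qed
  then have "idx s \<le> card {q..<q + m}"
    unfolding idx_def by (intro card_mono) auto
  then show "idx s \<le> m"
    by simp
qed

text \<open>One less than the number of labels: there are \<open>r + 1 - q\<close> marks and
  \<open>r + M mod 2\<close> gaps in \<open>[0, M/2]\<close>.\<close>

definition n :: nat where "n = 2 * e + M - q"

lemma n_eq: "n = 2 * r + M mod 2 - q"
  by (simp add: n_def)

text \<open>Ensures that the subtractions of \<open>q\<close> from \<open>r + M mod 2\<close> and in
  \<open>n\<close> are not truncated.\<close>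

lemma q_le_r: "q \<le> r + M mod 2"
proof -
  have "1 \<le> M div 2 + M mod 2"
    using M_pos by presburger
  then show ?thesis
    using q_le by linarith
qed

lemma lab_le_n:
  assumes "0 \<le> s" "s \<le> real M / 2"
  shows "lab s \<le> n"
proof (cases "s \<in> marks")
  case True
  then obtain i where "i \<in> {q..r}" "s = t i"
    by (auto simp: marks_def)
  then show ?thesis
    using True by (auto simp: lab_def idx_t n_eq)
next
  case False
  \<comment> \<open>For even \<open>M\<close> the last mark is the fold point, which is never
    strictly below \<open>s\<close>; for odd \<open>M\<close> all \<open>r + 1 - q\<close> marks may
    be.\<close>
  have "idx s \<le> r + M mod 2 - q"
  proof (cases "even M")
    case True
    then have "1 \<le> r"
      using M_pos by (auto elim!: evenE)
    then show ?thesis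
      using True t_r_even assms(2) q_le by (simp add: idx_le_iff)
  next
    case False
    then show ?thesis
      using q_le by (simp add: idx_le_iff odd_iff_mod_2_eq_one)
  qed
  then have "r + idx s \<le> n"
  proof -
    have "a + idx s \<le> 2 * a + b - q" if "idx s \<le> a + b - q" "q \<le> a + b" for a b
      using that by linarith
    then show ?thesis
      using q_le_r \<open>idx s \<le> r + M mod 2 - q\<close> unfolding n_eq by blast
  qed
  then show ?thesis
    using False by (simp add: lab_def)
qed

text \<open>Small labels are attained at marks, larger ones at midpoints of gaps, and for odd
  \<open>M\<close> the top label at the fold point.\<close>

lemma ex_lab:
  assumes "j \<le> n"
  obtains s where "0 \<le> s" "s \<le> real M / 2" "lab s = j"
proof (cases "q + j \<le> r")
  case True
  then have i: "q + j \<in> {q..r}"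
    by simp
  then have "lab (t (q + j)) = j"
    by (simp add: lab_def marks_def idx_t)
  then show ?thesis
    using True t_le_half[of "q + j"] by (intro that[of "t (q + j)"]) auto
next
  case False
  \<comment> \<open>The gap with label \<open>j\<close> has \<open>t i\<close> as its left end;
    since \<open>q + j > r\<close>, the subtraction is exact.\<close>
  define i where "i = j + q - 1 - r"
  have "j = a + (Suc (j + q - 1 - a) - q) \<and> j + q - 1 - a + 1 \<le> a + b"
    if "\<not> q + j \<le> a" "j \<le> 2 * a + b - q" "q \<le> a + b" for a b
    using that q_le by arith
  then have j: "j = r + (Suc i - q)" and i: "i + 1 \<le> r + M mod 2"
    using False assms q_le_r unfolding i_def n_eq by blast+
  show ?thesis
  proof (cases "i < r")
    case True
    define s where "s = (t i + t (Suc i)) / 2"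
    have s: "t i < s" "s < t (Suc i)"
      using t_less_iff[of i "Suc i"] by (auto simp: s_def simp del: t_less_iff)
    have "s \<notin> marks"
    proof
      assume "s \<in> marks"
      then obtain k where "s = t k"
        by (auto simp: marks_def)
      then show False
        using s by simp
    qed
    moreover have "idx s = Suc i - q"
      using s True by (intro idx_between) auto
    ultimately have "lab s = j"
      by (simp add: lab_def j)
    moreover have "0 \<le> s" "s \<le> real M / 2"
      using s True t_nonneg[of i] t_le_half[of "Suc i"] by linarith+
    ultimately show ?thesis
      using that by blast
  next
    case False
    then have "odd M" and ir: "i = r"
      using i by (auto simp: odd_iff_mod_2_eq_one)
    have less: "t k < real M / 2" if "k \<le> r" for k
      using t_r_odd[OF \<open>odd M\<close>] t_le_iff[of k r] that by linarith
    then have "real M / 2 \<notin> marks"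
      by (force simp: marks_def)
    moreover have "idx (real M / 2) = Suc i - q"
      using less ir by (intro idx_between) auto
    ultimately have "lab (real M / 2) = j"
      by (simp add: lab_def j)
    then show ?thesis
      by (intro that[of "real M / 2"]) auto
  qed
qed

text \<open>A sublevel set is a finite set of marks together with a closed half-line, the empty set
  or the whole line.\<close>

lemma closed_lab_le: "closed {s. lab s \<le> j}"
proof -
  have "closed {s. r + idx s \<le> j}"
  proof (cases "r \<le> j")
    case True
    then have "{s. r + idx s \<le> j} = {s. idx s \<le> j - r}"
      by auto
    also have "\<dots> = (if q + (j - r) \<le> r then {..t (q + (j - r))} else UNIV)"
      by (auto simp: idx_le_iff)
    finally show ?thesis
      by simp
  next
    case False
    then have "{s. r + idx s \<le> j} = {}"
      by auto
    then show ?thesis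
      by simp
  qed
  moreover have "finite (marks \<inter> {s. idx s \<le> j})"
    by (simp add: marks_def)
  moreover have "{s. lab s \<le> j} = (marks \<inter> {s. idx s \<le> j}) \<union> {s. r + idx s \<le> j}"
    by (auto simp: lab_def split: if_splits)
  ultimately show ?thesis
    by (simp add: closed_Un finite_imp_closed)
qed

definition label :: "real^3 \<Rightarrow> nat" where "label z = lab (depth M z)"

lemma depth_bounds:
  assumes "z \<in> circle_chain M"
  shows "0 \<le> depth M z" "depth M z \<le> real M / 2"
proof -
  obtain x y where "z = pt x y" "x \<in> {0..real M}"
    using assms by (rule circle_chainE)
  then show "0 \<le> depth M z" "depth M z \<le> real M / 2"
    by (auto simp: depth_def min_def)
qed

lemma image_label: "label ` circle_chain M = {..n}"
proof (intro set_eqI iffI)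
  fix j assume "j \<in> label ` circle_chain M"
  then show "j \<in> {..n}"
    using lab_le_n depth_bounds by (auto simp: label_def)
next
  fix j assume "j \<in> {..n}"
  then obtain s where s: "0 \<le> s" "s \<le> real M / 2" "lab s = j"
    using ex_lab[of j] by auto
  then have "pt s (sin (s * pi)) \<in> circle_chain M" "label (pt s (sin (s * pi))) = j"
    by (auto simp: label_def depth_def min_def)
  then show "j \<in> label ` circle_chain M"
    by blast
qed

lemma closedin_label_le: "closedin (top_of_set (circle_chain M)) {z \<in> circle_chain M. label z \<le> j}"
proof -
  have "continuous_on (circle_chain M) (depth M)"
    unfolding depth_def by (intro continuous_intros)
  from continuous_closedin_preimage[OF this closed_lab_le[of j]] show ?thesis
    by (simp add: vimage_def Int_def label_def)
qed

section \<open>Transitivity of the label group on its level sets\<close>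

abbreviation G :: "((real^3) \<Rightarrow> (real^3)) set" where
  "G \<equiv> label_group label (circle_chain M)"

lemma same_orbit_homeomorphism:
  assumes "homeomorphism (circle_chain M) (circle_chain M) f g"
    and "\<And>z. z \<in> circle_chain M \<Longrightarrow> label (f z) = label z"
    and "z \<in> circle_chain M"
  shows "same_orbit G z (f z)"
proof -
  have "(\<lambda>x. if x \<in> circle_chain M then f x else x) \<in> G"
    using homeomorphism_imp_Homeo[OF assms(1)] assms(2) by (simp add: label_group_def)
  then show ?thesis
    unfolding same_orbit_def by (rule bexI[rotated]) (simp add: assms(3))
qed

lemmas orbit_refl = same_orbit_refl[OF homeo_subgroup_label_group[of label "circle_chain M"]]
lemmas orbit_sym = same_orbit_sym[OF homeo_subgroup_label_group[of label "circle_chain M"]]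
lemmas orbit_trans = same_orbit_trans[OF homeo_subgroup_label_group[of label "circle_chain M"]]

text \<open>The upper point of the fibre over \<open>s\<close>, used as a normal form: orbits are
  compared through these points only.\<close>

definition rep :: "real \<Rightarrow> real^3" where "rep s = pt s \<bar>sin (s * pi)\<bar>"

text \<open>The two points of a fibre are exchanged by the reflection in the horizontal axis, which
  leaves the depth unchanged.\<close>

lemma same_orbit_rep_nth:
  assumes z: "z \<in> circle_chain M"
  shows "same_orbit G z (rep (z $ 1))"
proof -
  obtain x y where xy: "z = pt x y" "x \<in> {0..real M}" "\<bar>y\<bar> = \<bar>sin (x * pi)\<bar>"
    using z by (rule circle_chainE)
  let ?f = "\<lambda>z :: real^3. pt (z $ 1) (- z $ 2)"
  have "homeomorphism (circle_chain M) (circle_chain M) ?f ?f"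
    by (intro homeomorphismI continuous_intros) (auto elim!: circle_chainE)
  then have "same_orbit G z (?f z)"
    by (rule same_orbit_homeomorphism[OF _ _ z]) (simp add: label_def depth_def)
  moreover have "rep (z $ 1) = z \<or> rep (z $ 1) = ?f z"
    using xy by (auto simp: rep_def abs_if split: if_splits)
  ultimately show ?thesis
    using orbit_refl by auto
qed

text \<open>If the point is in the right half, the lifted reflection of the chain brings it to the
  left half first.\<close>

lemma same_orbit_rep_depth:
  assumes z: "z \<in> circle_chain M"
  shows "same_orbit G z (rep (depth M z))"
proof (cases "z $ 1 \<le> real M - z $ 1")
  case True
  then show ?thesis
    using same_orbit_rep_nth[OF z] by (simp add: depth_def)
next
  case False
  let ?h = "\<lambda>x. real M - x"
  have hom: "homeomorphism {0..real M} {0..real M} ?h ?h"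
    by (intro homeomorphismI continuous_intros) auto
  then have hom: "homeomorphism (circle_chain M) (circle_chain M) (lift ?h M) (lift ?h M)"
    by (rule homeomorphism_lift) auto
  then have "same_orbit G z (lift ?h M z)"
    by (rule same_orbit_homeomorphism[OF _ _ z]) (simp add: label_def depth_def lift_def min.commute)
  moreover have "lift ?h M z \<in> circle_chain M"
    using hom z by (auto simp: homeomorphism_def)
  then have "same_orbit G (lift ?h M z) (rep (lift ?h M z $ 1))"
    by (rule same_orbit_rep_nth)
  moreover have "lift ?h M z $ 1 = depth M z"
    using False by (simp add: lift_def depth_def)
  ultimately show ?thesis
    using orbit_trans[of z "lift ?h M z"] by simp
qed

lemma rep_in_circle_chain [simp]: "rep s \<in> circle_chain M \<longleftrightarrow> s \<in> {0..real M}"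
  by (simp add: rep_def)

lemma idx_less:
  assumes "i \<in> {q..r}" "s \<le> t i" "t i < s'"
  shows "idx s < idx s'"
  unfolding idx_def
proof (rule psubset_card_mono)
  have "i \<in> {k \<in> {q..r}. t k < s'}" "i \<notin> {k \<in> {q..r}. t k < s}"
    using assms by auto
  moreover have "{k \<in> {q..r}. t k < s} \<subseteq> {k \<in> {q..r}. t k < s'}"
    using assms by auto
  ultimately show "{k \<in> {q..r}. t k < s} \<subset> {k \<in> {q..r}. t k < s'}"
    by blast
qed simp

text \<open>Both abscissae lie in one gap. A homeomorphism of \<open>[0, M]\<close> supported in
  that gap moves \<open>s\<close> to \<open>s'\<close>, and its lift preserves all labels.\<close>

lemma same_orbit_rep_lift:
  assumes s: "0 < s" "s \<le> s'" "s' \<le> real M / 2"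
    and marks: "s \<notin> marks" "s' \<notin> marks" and idx: "idx s = idx s'"
  shows "same_orbit G (rep s) (rep s')"
proof -
  \<comment> \<open>Marks and their mirror images are removed because labels see only the folded
    position, integers because a lift must respect them.\<close>
  define U where "U = {0<..<real M} - (marks \<union> (\<lambda>x. real M - x) ` marks \<union> \<int>)"
  have mark_half: "x \<le> real M / 2" if "x \<in> marks" for x
    using that t_le_half by (auto simp: marks_def)
  have no_mark: "x \<notin> marks" if x: "s \<le> x" "x \<le> s'" for x
  proof
    assume "x \<in> marks"
    then obtain i where i: "i \<in> {q..r}" "x = t i"
      by (auto simp: marks_def)
    have "x \<noteq> s'"
      using \<open>x \<in> marks\<close> marks(2) by auto
    then show False
      using idx_less[of i s s'] i x idx by simp
  qed
  have "{s..s'} \<subseteq> U"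
  proof
    fix x assume x: "x \<in> {s..s'}"
    then have x0: "0 < x" "x \<le> real M / 2" "x \<notin> marks"
      using s no_mark by auto
    moreover have "x < real M"
      using x0 M_pos by linarith
    moreover have "x \<notin> (\<lambda>x. real M - x) ` marks"
    proof
      assume "x \<in> (\<lambda>x. real M - x) ` marks"
      then obtain y where "y \<in> marks" "x = real M - y"
        by auto
      moreover from this have "x = y"
        using mark_half[of y] x0(2) by linarith
      ultimately show False
        using x0(3) by simp
    qed
    \<comment> \<open>A positive integer \<open>k\<close> up to \<open>M/2\<close> is itself the
      mark \<open>t (e + k)\<close>.\<close>
    moreover have "x \<notin> \<int>"
    proof
      assume "x \<in> \<int>"
      then obtain k where k: "x = real k"
        using x0(1) by (metis Ints_cases less_imp_le of_int_0_le_iff of_nat_nat of_int_of_nat_eq)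
      then have "1 \<le> k" "2 * k \<le> M"
        using x0 by auto
      then have "e + k \<in> {q..r}" "x = t (e + k)"
        using q_le k by (auto simp: t_add)
      then show False
        using x0(3) by (auto simp: marks_def)
    qed
    ultimately show "x \<in> U"
      by (simp add: U_def)
  qed
  then have sU: "s \<in> U" "{s..s'} \<subseteq> U"
    using s by auto
  define S where "S = connected_component_set U s"
  have "finite marks"
    by (simp add: marks_def)
  then have "open U"
    unfolding U_def by (intro open_Diff closed_Un finite_imp_closed closed_Ints) auto
  then have S: "open S" "connected S" "S \<subseteq> U"
    unfolding S_def by (auto simp: open_connected_component connected_component_subset)
  have "{s..s'} \<subseteq> S"
    unfolding S_def using s sU(2) by (intro connected_component_maximal) auto
  then have "s \<in> S" "s' \<in> S"
    using s by auto
  moreover have "S \<subseteq> {0..real M}"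
    using S(3) by (auto simp: U_def)
  ultimately obtain h k where hk: "homeomorphism {0..real M} {0..real M} h k" "h s = s'"
    and off: "\<And>x. x \<notin> S \<Longrightarrow> h x = x" "\<And>x. x \<notin> S \<Longrightarrow> k x = x"
    using homeomorphism_moving_point_real[OF S(1,2)] by blast
  have Ints: "x \<notin> S" if "x \<in> \<int>" for x
    using S(3) that by (auto simp: U_def)
  have hom: "homeomorphism (circle_chain M) (circle_chain M) (lift h M) (lift k M)"
    using hk(1) by (rule homeomorphism_lift) (simp_all add: off Ints)
  \<comment> \<open>\<open>S\<close> may contain the fold point, so depth need not be monotone on
    it. However, passing from \<open>x\<close> to \<open>x'\<close> crosses neither a mark nor a
    mirrored mark, so the same marks stay below the depth.\<close>
  have lab_S: "lab (min x (real M - x)) = lab (min x' (real M - x'))"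
    if x: "x \<in> S" "x' \<in> S" "x \<le> x'" for x x'
  proof -
    have sub: "{x..x'} \<subseteq> U"
      using connected_contains_Icc[OF S(2) x(1,2)] S(3) by blast
    have nm: "min y (real M - y) \<notin> marks" if "y \<in> U" for y
    proof
      assume "min y (real M - y) \<in> marks"
      then have "y \<in> marks \<or> y \<in> (\<lambda>x. real M - x) ` marks"
        by (auto simp: min_def image_iff split: if_splits intro: bexI[of _ "real M - y"])
      then show False
        using \<open>y \<in> U\<close> by (auto simp: U_def)
    qed
    have "t i < min x (real M - x) \<longleftrightarrow> t i < min x' (real M - x')" if i: "i \<in> {q..r}" for i
    proof -
      have "t i \<in> marks" "real M - t i \<in> (\<lambda>x. real M - x) ` marks"
        using i by (auto simp: marks_def)
      then have "t i \<notin> {x..x'}" "real M - t i \<notin> {x..x'}"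
        using sub by (auto simp: U_def)
      then show ?thesis
        using x(3) by (auto simp: min_def)
    qed
    then have "idx (min x (real M - x)) = idx (min x' (real M - x'))"
      unfolding idx_def by (metis (mono_tags, lifting))
    moreover have "min x (real M - x) \<notin> marks" "min x' (real M - x') \<notin> marks"
      using nm sub x(3) by auto
    ultimately show ?thesis
      by (simp add: lab_def)
  qed
  have "same_orbit G (rep s) (lift h M (rep s))"
  proof (rule same_orbit_homeomorphism[OF hom])
    fix z assume z: "z \<in> circle_chain M"
    let ?x = "z $ 1"
    show "label (lift h M z) = label z"
    proof (cases "?x \<in> S")
      case True
      \<comment> \<open>Outside \<open>S\<close> the inverse \<open>k\<close> is the identity, so a
        point leaving \<open>S\<close> under \<open>h\<close> could not return to
        \<open>?x\<close>.\<close>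
      have "h ?x \<in> S"
      proof (rule ccontr)
        assume "h ?x \<notin> S"
        then have "k (h ?x) = h ?x"
          by (rule off)
        moreover have "k (h ?x) = ?x"
          using hk(1) True \<open>S \<subseteq> {0..real M}\<close> by (auto simp: homeomorphism_def)
        ultimately show False
          using True \<open>h ?x \<notin> S\<close> by simp
      qed
      have "lab (min ?x (real M - ?x)) = lab (min (h ?x) (real M - h ?x))"
        using lab_S[OF True \<open>h ?x \<in> S\<close>] lab_S[OF \<open>h ?x \<in> S\<close> True, symmetric] by linarith
      then show ?thesis
        by (simp only: label_def depth_def lift_def pt_nth)
    next
      case False
      then show ?thesis
        by (simp add: label_def depth_def lift_def off)
    qed
  next
    show "rep s \<in> circle_chain M"
      using s by simp
  qed
  moreover have "lift h M (rep s) \<in> circle_chain M" "lift h M (rep s) $ 1 = s'"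
    using hom s hk(2) by (auto simp: homeomorphism_def lift_def rep_def)
  then have "same_orbit G (lift h M (rep s)) (rep s')"
    using same_orbit_rep_nth by metis
  ultimately show ?thesis
    using orbit_trans by blast
qed

text \<open>With the tip unmarked, the first mark is \<open>t 1\<close>, equal to
  \<open>1 / (2 * e + 2)\<close>, or to 1 if \<open>e = 0\<close>; half the first value is safely
  below it.\<close>

lemma small_not_mark:
  assumes "q = 1" "s \<le> 1 / (4 * real e + 4)"
  shows "s \<notin> marks" "idx s = 0"
proof -
  have "1 / (4 * real e + 4) < t 1"
  proof -
    have "t 1 = (if e = 0 then 1 else 1 / (2 * real e + 2))"
      by (simp add: t_def)
    then show ?thesis
      by (simp add: divide_simps)
  qed
  then have "s < t i" if "i \<in> {q..r}" for i
    using assms that t_le_iff[of 1 i] by (simp del: t_le_iff One_nat_def)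
  then have less: "\<forall>i \<in> {q..r}. s < t i"
    by blast
  then show "s \<notin> marks"
    unfolding marks_def by blast
  have "{i \<in> {q..r}. t i < s} = {}"
  proof (rule equals0I)
    fix i assume "i \<in> {i \<in> {q..r}. t i < s}"
    then have "i \<in> {q..r}" "t i < s"
      by simp_all
    then show False
      using bspec[OF less, of i] by linarith
  qed
  then show "idx s = 0"
    by (simp only: idx_def card.empty)
qed

text \<open>An unmarked tip belongs to the first gap, but no lift moves it into the interior of that
  gap. A \<open>tip_map\<close> supported where the label is constantly \<open>r\<close>
  does.\<close>

lemma same_orbit_rep_tip:
  assumes "q = 1"
  obtains u where "0 < u" "u \<le> 1 / (4 * real e + 4)" "same_orbit G (rep 0) (rep u)"
proof -
  define c where "c = 1 / (4 * real e + 4)"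
  define b where "b = sin (c * pi)"
  have c: "0 < c" "c \<le> 1 / 4"
    by (auto simp: c_def divide_simps)
  have b: "0 < b"
    using c unfolding b_def by (intro sin_gt_zero) auto
  \<comment> \<open>The second coordinate of the tip goes from 0 to \<open>b / 2\<close>, which is
    nonzero, so the image has positive abscissa.\<close>
  obtain h k where hk: "homeomorphism {-b..b} {-b..b} h k" "h 0 = b / 2"
    and off: "\<And>x. x \<notin> {-b<..<b} \<Longrightarrow> h x = x" "\<And>x. x \<notin> {-b<..<b} \<Longrightarrow> k x = x"
    by (rule homeomorphism_moving_point_real[of "{-b<..<b}" "{-b..b}" 0 "b / 2"]) (use b in auto)
  have hom: "homeomorphism (circle_chain M) (circle_chain M) (tip_map c h) (tip_map c k)"
    using c M_pos hk(1) off unfolding b_def by (intro homeomorphism_tip_map) auto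
  have chart: "x \<in> {0..c} \<and> \<bar>y\<bar> = \<bar>sin (x * pi)\<bar> \<longleftrightarrow> \<bar>y\<bar> \<le> b \<and> x = arcsin \<bar>y\<bar> / pi" for x y
    using c unfolding b_def by (intro tip_chart) auto
  have label_tip: "label z = r" if "z \<in> circle_chain M" "z $ 1 \<le> c" for z
  proof -
    have "depth M z \<le> 1 / (4 * real e + 4)"
      using that by (simp add: depth_def c_def)
    then show ?thesis
      using small_not_mark[OF assms] by (simp add: label_def lab_def)
  qed
  have tip_le: "tip_map c h z $ 1 \<le> c" if z: "z \<in> circle_chain M" "z $ 1 \<le> c" for z
  proof -
    obtain x y where xy: "z = pt x y" "x \<in> {0..real M}" "\<bar>y\<bar> = \<bar>sin (x * pi)\<bar>"
      using z(1) by (rule circle_chainE)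
    then have "\<bar>y\<bar> \<le> b"
      using chart[of x y] z(2) by simp
    then have "h y \<in> {-b..b}"
      using hk(1) by (auto simp: homeomorphism_def abs_le_iff)
    then have "arcsin \<bar>h y\<bar> / pi \<in> {0..c}"
      using chart[of "arcsin \<bar>h y\<bar> / pi" "h y"] by (simp add: abs_le_iff)
    then show ?thesis
      using z(2) by (simp add: xy(1) tip_map_def)
  qed
  have tip0: "rep 0 \<in> circle_chain M"
    by simp
  have "same_orbit G (rep 0) (tip_map c h (rep 0))"
  proof (rule same_orbit_homeomorphism[OF hom _ tip0])
    fix z assume z: "z \<in> circle_chain M"
    then have "tip_map c h z \<in> circle_chain M"
      using hom by (auto simp: homeomorphism_def)
    then show "label (tip_map c h z) = label z"
      using z label_tip tip_le by (cases "z $ 1 \<le> c") (simp_all add: tip_map_def)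
  qed
  moreover have tA: "tip_map c h (rep 0) \<in> circle_chain M"
    using hom tip0 by (auto simp: homeomorphism_def)
  define u where "u = tip_map c h (rep 0) $ 1"
  have "same_orbit G (tip_map c h (rep 0)) (rep u)"
    unfolding u_def using tA by (rule same_orbit_rep_nth)
  ultimately have "same_orbit G (rep 0) (rep u)"
    using orbit_trans by blast
  moreover have "u \<le> c"
    unfolding u_def using tip_le[OF tip0] c by (simp add: rep_def)
  moreover have "0 < u"
  proof -
    have "u = arcsin (b / 2) / pi"
      using c b by (simp add: u_def rep_def tip_map_def hk(2))
    moreover have "b \<le> 1"
      by (simp add: b_def)
    then have "0 < arcsin (b / 2)"
      using b arcsin_less_arcsin[of 0 "b / 2"] by simp
    ultimately show ?thesis
      by simp
  qed
  ultimately show ?thesis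
    using that[of u] by (simp add: c_def)
qed

text \<open>Equal labels mean the same mark, where nothing has to move, or the same gap, where lifts
  act transitively once a position 0 has been replaced by a positive one.\<close>

lemma same_orbit_rep:
  assumes s: "0 \<le> s" "s \<le> real M / 2" and s': "0 \<le> s'" "s' \<le> real M / 2" and lab: "lab s = lab s'"
  shows "same_orbit G (rep s) (rep s')"
proof -
  have lab_mark: "lab s < r + 1 - q" if "s \<in> marks" for s
    using that by (auto simp: lab_def marks_def idx_t)
  \<comment> \<open>Gap labels start right after the mark labels: for \<open>q = 0\<close> the mark
    0 lies below \<open>s\<close>, so \<open>idx s\<close> is at least 1; for \<open>q = 1\<close>
    the bound is just \<open>r\<close>.\<close>
  have lab_nonmark: "r + 1 - q \<le> lab s" if "s \<notin> marks" "0 \<le> s" for s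
  proof (cases "q = 0")
    case True
    have "t 0 \<in> marks"
      unfolding marks_def using True by (intro imageI) auto
    then have "0 \<in> marks"
      by simp
    then have "s \<noteq> 0"
      using that by auto
    then have "idx 0 < idx s"
      using True that by (intro idx_less[of 0]) auto
    moreover have "lab s = r + idx s"
      using that by (simp add: lab_def)
    ultimately show ?thesis
      by linarith
  next
    case False
    then show ?thesis
      using q_le that by (simp add: lab_def)
  qed
  have same: "s \<in> marks \<longleftrightarrow> s' \<in> marks"
    using lab lab_mark lab_nonmark s(1) s'(1) by (metis linorder_not_less)
  show ?thesis
  proof (cases "s \<in> marks")
    case True
    then obtain i j where "i \<in> {q..r}" "j \<in> {q..r}" "s = t i" "s' = t j"
      using same by (auto simp: marks_def)
    then have "s = s'"
      using lab True same by (auto simp: lab_def idx_t)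
    then show ?thesis
      using orbit_refl by simp
  next
    case False
    have pos: "\<exists>u. 0 < u \<and> u \<le> real M / 2 \<and> u \<notin> marks \<and> idx u = idx s \<and> same_orbit G (rep s) (rep u)"
      if s: "0 \<le> s" "s \<le> real M / 2" "s \<notin> marks" for s
    proof (cases "s = 0")
      case True
      have "q = 1"
      proof (rule ccontr)
        assume "q \<noteq> 1"
        then have "t 0 \<in> marks"
          using q_le unfolding marks_def by (intro imageI) auto
        then show False
          using s True by simp
      qed
      then obtain u where u: "0 < u" "u \<le> 1 / (4 * real e + 4)" "same_orbit G (rep 0) (rep u)"
        by (rule same_orbit_rep_tip)
      have "1 / (4 * real e + 4) \<le> 1 / 2"
        by (simp add: divide_simps)
      moreover have "1 \<le> real M"
        using M_pos by simp
      ultimately have "u \<le> real M / 2"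
        using u(2) by linarith
      moreover have "u \<notin> marks" "idx u = idx s"
        using small_not_mark[OF \<open>q = 1\<close> u(2)] small_not_mark[OF \<open>q = 1\<close>, of 0] True by auto
      ultimately show ?thesis
        using u True by blast
    next
      case False
      then show ?thesis
        using s orbit_refl by (intro exI[of _ s]) auto
    qed
    obtain u where u: "0 < u" "u \<le> real M / 2" "u \<notin> marks" "idx u = idx s" "same_orbit G (rep s) (rep u)"
      using pos[OF s False] by blast
    obtain u' where u': "0 < u'" "u' \<le> real M / 2" "u' \<notin> marks" "idx u' = idx s'"
        "same_orbit G (rep s') (rep u')"
      using pos[OF s'] False same by blast
    have "idx u = idx u'"
      using lab False same u(4) u'(4) by (simp add: lab_def)
    then have "same_orbit G (rep u) (rep u')"
      using same_orbit_rep_lift[of u u'] same_orbit_rep_lift[of u' u] u u' orbit_sym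
      by (cases "u \<le> u'") auto
    then show ?thesis
      using orbit_trans[OF u(5)] orbit_trans[OF _ orbit_sym[OF u'(5)]] by blast
  qed
qed

lemma same_orbit_if_label_eq:
  assumes "z \<in> circle_chain M" "w \<in> circle_chain M" "label z = label w"
  shows "same_orbit G z w"
proof -
  have "same_orbit G (rep (depth M z)) (rep (depth M w))"
    using assms depth_bounds by (intro same_orbit_rep) (auto simp: label_def)
  then show ?thesis
    using same_orbit_rep_depth[OF assms(1)] same_orbit_rep_depth[OF assms(2)] orbit_trans orbit_sym
    by blast
qed

lemma height_label_group: "height G (circle_chain M) = enat n"
proof (rule antisym)
  show "height G (circle_chain M) \<le> enat n"
    using same_orbit_if_label_eq image_label by (rule height_le_enat)
  show "enat n \<le> height G (circle_chain M)"
    using homeo_subgroup_label_group _ closedin_label_le image_label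
    by (rule enat_le_height) (simp add: label_group_def)
qed

lemma n_in_P_h: "enat n \<in> P_h (circle_chain M)"
  unfolding P_h_def
proof (rule CollectI, intro exI conjI)
  show "enat n = height G (circle_chain M)"
    by (simp only: height_label_group)
qed (rule homeo_subgroup_label_group)

end

text \<open>For \<open>e = 0\<close> and \<open>q = 1\<close> the marks are the integers from 1 to
  \<open>M div 2\<close>. The label depends only on comparisons of the depth with these, and every
  homeomorphism preserves those.\<close>

lemma Homeo_label:
  assumes M: "M > 0" and f: "f \<in> Homeo (circle_chain M)" and z: "z \<in> circle_chain M"
  shows "marked_chain.label M 0 1 (f z) = marked_chain.label M 0 1 z"
proof -
  interpret marked_chain M 0 1
    using M by unfold_locales auto
  have t: "t i = real i" for i
    by (simp add: t_def)
  have *: "depth M (f z) < real i \<longleftrightarrow> depth M z < real i" "depth M (f z) = real i \<longleftrightarrow> depth M z = real i"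
    if "i \<in> {1..0 + M div 2}" for i
  proof -
    have "1 \<le> i" "2 * i \<le> M"
      using that by auto
    then show "depth M (f z) < real i \<longleftrightarrow> depth M z < real i"
      "depth M (f z) = real i \<longleftrightarrow> depth M z = real i"
      by (rule Homeo_depth_iff[OF f z])+
  qed
  have "depth M (f z) \<in> marks \<longleftrightarrow> depth M z \<in> marks"
  proof -
    have "(\<exists>i \<in> {1..0 + M div 2}. depth M (f z) = real i) \<longleftrightarrow> (\<exists>i \<in> {1..0 + M div 2}. depth M z = real i)"
      by (intro bex_cong refl *(2))
    then show ?thesis
      by (simp only: marks_def t image_iff)
  qed
  moreover have "real i < depth M (f z) \<longleftrightarrow> real i < depth M z" if "i \<in> {1..0 + M div 2}" for i
    using *[OF that] by linarith
  then have "idx (depth M (f z)) = idx (depth M z)"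
    unfolding idx_def t by (intro arg_cong[where f = card] Collect_cong) blast
  ultimately show ?thesis
    by (simp only: label_def lab_def)
qed

theorem theorem5p6:
  fixes p :: nat
  shows "\<exists>A :: (real^3) set. topological_graph A \<and>
           P_h A = {enat n | n. p \<le> n} \<union> {\<infinity>}"
proof (intro exI conjI)
  let ?A = "circle_chain (Suc p)"
  show "topological_graph ?A"
    by (rule topological_graph_circle_chain) simp
  show "P_h ?A = {enat n | n. p \<le> n} \<union> {\<infinity>}"
  proof (intro set_eqI iffI)
    fix x assume "x \<in> P_h ?A"
    then obtain H where H: "homeo_subgroup H ?A" "x = height H ?A"
      by (auto simp: P_h_def)
    \<comment> \<open>With these parameters \<open>n\<close> equals \<open>p\<close>, and the
      labelling is invariant under every subgroup.\<close>
    interpret marked_chain "Suc p" 0 1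
      by unfold_locales auto
    have "enat n \<le> height H ?A"
    proof (rule enat_le_height[OF H(1) _ closedin_label_le image_label])
      show "label (f z) = label z" if "f \<in> H" "z \<in> ?A" for f z
        using that H(1) by (intro Homeo_label) (auto simp: homeo_subgroup_def)
    qed
    then show "x \<in> {enat n | n. p \<le> n} \<union> {\<infinity>}"
      unfolding H(2)[symmetric] n_def by (cases x) auto
  next
    fix x assume "x \<in> {enat n | n. p \<le> n} \<union> {\<infinity>}"
    then consider k where "x = enat k" "p \<le> k" | "x = \<infinity>"
      by blast
    then show "x \<in> P_h ?A"
    proof cases
      case 1
      \<comment> \<open>The parity of \<open>k - p\<close> decides whether the tips are marked:
        \<open>q = 1\<close> in the even case, \<open>q = 0\<close> in the odd case.\<close>
      obtain e q where q: "q \<le> 1" and k: "2 * e + Suc p - q = k"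
      proof (cases "even (k - p)")
        case True
        then obtain c where "k - p = 2 * c"
          by (rule evenE)
        then have "2 * c + Suc p - 1 = k"
          using 1(2) by simp
        then show ?thesis
          by (intro that[of 1 c]) simp_all
      next
        case False
        then obtain c where "k - p = 2 * c + 1"
          by (rule oddE)
        then have "2 * c + Suc p - 0 = k"
          using 1(2) by simp
        then show ?thesis
          by (intro that[of 0 c]) simp_all
      qed
      interpret marked_chain "Suc p" e q
        by unfold_locales (rule zero_less_Suc q)+
      have "n = k"
        by (simp only: n_def k)
      then show ?thesis
        using n_in_P_h 1(1) by simp
    next
      case 2
      have "homeo_subgroup {id} ?A"
        by (auto simp: homeo_subgroup_def Homeo_id)
      then show ?thesis
        using height_trivial_group[OF infinite_circle_chain[of "Suc p"]] 2
        unfolding P_h_def by (simp, metis)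
    qed
  qed
qed

end
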